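(* Assume in addition that for every $i$, $p\mapsto H_i(x,p)$ is strictly convex for every $x\in\mathbb T^N$, and $(x,p)\mapsto H_i(x,p)$ is locally Lipschitz continuous on $\mathbb T^N\times\mathbb R^N$. If $\mathbf u$ is a subsolution of the critical system (HJ$\beta$), then $D^+u_i(x)\ne\emptyset$ for every $i\in\{1,\dots,m\}$ and every $x\in\mathcal A$. If moreover $\mathbf u$ is a solution of (HJ$\beta$), then $D^+u_i(x)\neq\emptyset$ for every $i$ and every $x\in\mathbb T^N$.
   Context: Setting: $N,m\ge1$, $\mathbb T^N$ the flat torus. For $i=1,\dots,m$, $H_i:\mathbb T^N\times\mathbb R^N\to\mathbb R$ is continuous, and $p\mapsto H_i(x,p)$ is convex and coercive (w.l.o.g. superlinear) for every $x$. $A=(a_{ij})$ is an $m\times m$ matrix with $a_{ij}\le0$ for $i\ne j$, $\sum_j a_{ij}=0$ for every $i$, and irreducible (for every nonempty $W\subsetneq\{1,\dots,m\}$ there are $i\in W$, $j\notin W$ with $a_{ij}<0$). (HJ$\alpha$) is the system $H_i(x,Du_i)+\sum_{j=1}^m a_{ij}u_j(x)=\alpha$ in $\mathbb T^N$, $i=1,\dots,m$, with viscosity sub/supersolutions $\mathbf u:\mathbb T^N\to\mathbb R^m$ defined componentwise via super/subdifferentials; $\beta=\min\{\alpha:\ \text{(HJ}\alpha\text{) admits subsolutions}\}$. $D^+f(x)$ denotes the set of differentials at $x$ of $C^1$ functions supertangent to $f$ at $x$ (the superdifferential). The Aubry set $\mathcal A$ of the system is the set of $y$ such that, for every value $\mathbf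 a$ taken at $y$ by some critical subsolution, the maximal critical subsolution taking value $\mathbf a$ at $y$ is a solution of (HJ$\beta$) on $\mathbb T^N$. *)

theory Defs
  imports "HOL-Analysis.Analysis"
begin

text \<open>The flat torus T^N is represented by Z^N-periodic objects on real^'n.\<close>

definition int_vec :: "real^'n \<Rightarrow> bool" where
  "int_vec k \<longleftrightarrow> (\<forall>l. k $ l \<in> \<int>)"

definition Zperiodic :: "(real^'n \<Rightarrow> 'b) \<Rightarrow> bool" where
  "Zperiodic f \<longleftrightarrow> (\<forall>x k. int_vec k \<longrightarrow> f (x + k) = f x)"

definition strictly_convex_on :: "'a::real_vector set \<Rightarrow> ('a \<Rightarrow> real) \<Rightarrow> bool" where
  "strictly_convex_on S f \<longleftrightarrow>
     (\<forall>x\<in>S. \<forall>y\<in>S. x \<noteq> y \<longrightarrow> (\<forall>t::real. 0 < t \<and> t < 1 \<longrightarrow>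
        f ((1 - t) *\<^sub>R x + t *\<^sub>R y) < (1 - t) * f x + t * f y))"

definition superdiff :: "(real^'n \<Rightarrow> real) \<Rightarrow> real^'n \<Rightarrow> (real^'n) set" where
  "superdiff f x = {p. \<exists>\<phi> \<phi>'.
      (\<forall>y. (\<phi> has_derivative (\<lambda>h. \<phi>' y \<bullet> h)) (at y)) \<and> continuous_on UNIV \<phi>' \<and>
      \<phi>' x = p \<and> \<phi> x = f x \<and> (\<exists>e>0. \<forall>y. dist y x < e \<longrightarrow> f y \<le> \<phi> y)}"

definition subdiff :: "(real^'n \<Rightarrow> real) \<Rightarrow> real^'n \<Rightarrow> (real^'n) set" where
  "subdiff f x = {p. \<exists>\<phi> \<phi>'.
      (\<forall>y. (\<phi> has_derivative (\<lambda>h. \<phi>' y \<bullet> h)) (at y)) \<and> continuous_on UNIV \<phi>' \<and>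
      \<phi>' x = p \<and> \<phi> x = f x \<and> (\<exists>e>0. \<forall>y. dist y x < e \<longrightarrow> \<phi> y \<le> f y)}"

definition sys_subsol ::
  "('m::finite \<Rightarrow> real^'n \<Rightarrow> real^'n \<Rightarrow> real) \<Rightarrow> real^'m^'m \<Rightarrow> real \<Rightarrow> (real^'n \<Rightarrow> real^'m) \<Rightarrow> bool" where
  "sys_subsol H A \<alpha> u \<longleftrightarrow>
     (\<forall>i. continuous_on UNIV (\<lambda>x. u x $ i)) \<and> Zperiodic u \<and>
     (\<forall>i x. \<forall>p\<in>superdiff (\<lambda>y. u y $ i) x. H i x p + (\<Sum>j\<in>UNIV. A $ i $ j * u x $ j) \<le> \<alpha>)"

definition sys_supersol ::
  "('m::finite \<Rightarrow> real^'n \<Rightarrow> real^'n \<Rightarrow> real) \<Rightarrow> real^'m^'m \<Rightarrow> real \<Rightarrow> (real^'n \<Rightarrow> real^'m) \<Rightarrow> bool" where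
  "sys_supersol H A \<alpha> u \<longleftrightarrow>
     (\<forall>i. continuous_on UNIV (\<lambda>x. u x $ i)) \<and> Zperiodic u \<and>
     (\<forall>i x. \<forall>p\<in>subdiff (\<lambda>y. u y $ i) x. H i x p + (\<Sum>j\<in>UNIV. A $ i $ j * u x $ j) \<ge> \<alpha>)"

definition sys_sol ::
  "('m::finite \<Rightarrow> real^'n \<Rightarrow> real^'n \<Rightarrow> real) \<Rightarrow> real^'m^'m \<Rightarrow> real \<Rightarrow> (real^'n \<Rightarrow> real^'m) \<Rightarrow> bool" where
  "sys_sol H A \<alpha> u \<longleftrightarrow> sys_subsol H A \<alpha> u \<and> sys_supersol H A \<alpha> u"

text \<open>Critical value beta = min of alpha for which (HJ alpha) has subsolutions
  (the minimum is attained under the standing assumptions, so we take the infimum).\<close>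
definition crit_value ::
  "('m::finite \<Rightarrow> real^'n \<Rightarrow> real^'n \<Rightarrow> real) \<Rightarrow> real^'m^'m \<Rightarrow> real" where
  "crit_value H A = Inf {\<alpha>. \<exists>u. sys_subsol H A \<alpha> u}"

definition max_crit_subsol ::
  "('m::finite \<Rightarrow> real^'n \<Rightarrow> real^'n \<Rightarrow> real) \<Rightarrow> real^'m^'m \<Rightarrow> real^'n \<Rightarrow> real^'m \<Rightarrow> (real^'n \<Rightarrow> real^'m) \<Rightarrow> bool" where
  "max_crit_subsol H A y a w \<longleftrightarrow>
     sys_subsol H A (crit_value H A) w \<and> w y = a \<and>
     (\<forall>v. sys_subsol H A (crit_value H A) v \<and> v y = a \<longrightarrow> (\<forall>x i. v x $ i \<le> w x $ i))"

text \<open>Aubry set (as a Z^N-periodic subset of real^'n).\<close>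
definition aubry_set ::
  "('m::finite \<Rightarrow> real^'n \<Rightarrow> real^'n \<Rightarrow> real) \<Rightarrow> real^'m^'m \<Rightarrow> (real^'n) set" where
  "aubry_set H A = {y. \<forall>u. sys_subsol H A (crit_value H A) u \<longrightarrow>
      (\<forall>w. max_crit_subsol H A y (u y) w \<longrightarrow> sys_sol H A (crit_value H A) w)}"

end

theory Submission
  imports Defs
begin

text \<open>A critical subsolution satisfies a pointwise bound \<open>A u \<le> C\<close>, which by irreducibility controls the
  oscillation of the vector \<open>u(x)\<close>; hence the critical subsolutions are equi-Lipschitz and the maximal
  subsolution through a given value exists. At a point of the Aubry
  set it touches \<open>u\<close> from above and is itself a solution, so everything reduces to solutions. For a solution each component solves a
  scalar equation with strictly convex Hamiltonian, Lipschitz in \<open>x\<close>, and a three-point doubling of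
  variables makes it semiconcave with a modulus. Superdifferentials exist at a dense set of points;
  semiconcavity makes the corresponding upper bounds uniform, so they pass to the limit at every point.\<close>

text \<open>Strict convexity is only qualitative: a gap \<delta> once two momenta are \<epsilon>
  apart. Hence the modulus is a family \<epsilon> r + M(\<epsilon>) r^2 rather than a multiple of
  r^2, and since test functions must be C^1 it has to be integrated before it can serve as one.
  Three points are used because the two halves of the notion of solution point in opposite
  directions: the subsolution property bounds the Hamiltonian from above at the momenta of the two
  end points, the supersolution property bounds it from below at their convex combination, and
  strict convexity leaves no room between the two. All weights \<open>l\<close> are treated, with
  the factor \<open>l * (1 - l)\<close>, and not only midpoints: dividing by a small
  \<open>l\<close> is what turns the infinitesimal information in a superdifferential into a bound
  valid at every distance. The Lipschitz bound on all components of \<open>u\<close> enters twice: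
  it confines momenta to a ball, where compactness makes strict convexity uniform, and it makes the
  coupling term a Lipschitz function of the point, so that each equation can be treated as
  scalar.\<close>

section \<open>Elementary calculus of super- and subdifferentials\<close>

lemma superdiff_touchI:
  fixes u \<phi> :: "real^'n \<Rightarrow> real"
  assumes "\<And>z. (\<phi> has_derivative (\<lambda>h. \<phi>' z \<bullet> h)) (at z)" and "continuous_on UNIV \<phi>'"
    and "0 < e" and "\<And>z. dist z y < e \<Longrightarrow> u z - \<phi> z \<le> u y - \<phi> y"
  shows "\<phi>' y \<in> superdiff u y"
  unfolding superdiff_def mem_Collect_eq
proof (intro exI conjI)
  show "\<forall>z. ((\<lambda>z. \<phi> z + (u y - \<phi> y)) has_derivative (\<lambda>h. \<phi>' z \<bullet> h)) (at z)"
    using assms(1) by (auto intro: has_derivative_add_const)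
  show "\<forall>z. dist z y < e \<longrightarrow> u z \<le> \<phi> z + (u y - \<phi> y)"
    using assms(4) by force
qed (use assms in auto)

lemma subdiff_eq_uminus_superdiff:
  fixes u :: "real^'n \<Rightarrow> real"
  shows "subdiff u x = uminus ` superdiff (\<lambda>y. - u y) x"
proof (intro set_eqI iffI)
  fix p assume "p \<in> subdiff u x"
  then obtain \<phi> \<phi>' e where \<phi>: "\<And>y. (\<phi> has_derivative (\<lambda>h. \<phi>' y \<bullet> h)) (at y)"
    "continuous_on UNIV \<phi>'" "\<phi>' x = p" "\<phi> x = u x" "e > 0" "\<And>y. dist y x < e \<Longrightarrow> \<phi> y \<le> u y"
    unfolding subdiff_def by blast
  have "((\<lambda>y. - \<phi> y) has_derivative (\<lambda>h. - \<phi>' y \<bullet> h)) (at y)" for y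
    using has_derivative_minus[OF \<phi>(1)[of y]] by simp
  then have "- \<phi>' x \<in> superdiff (\<lambda>y. - u y) x"
    by (rule superdiff_touchI[where e = e]) (use \<phi> in \<open>auto intro!: continuous_intros\<close>)
  then show "p \<in> uminus ` superdiff (\<lambda>y. - u y) x"
    using \<phi>(3) by (auto intro: image_eqI[where x = "- p"])
next
  fix p assume "p \<in> uminus ` superdiff (\<lambda>y. - u y) x"
  then obtain q where q: "p = - q" "q \<in> superdiff (\<lambda>y. - u y) x" by blast
  then obtain \<phi> \<phi>' e where \<phi>: "\<And>y. (\<phi> has_derivative (\<lambda>h. \<phi>' y \<bullet> h)) (at y)"
    "continuous_on UNIV \<phi>'" "\<phi>' x = q" "\<phi> x = - u x" "e > 0" "\<And>y. dist y x < e \<Longrightarrow> - u y \<le> \<phi> y"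
    unfolding superdiff_def by blast
  have deriv: "((\<lambda>y. - \<phi> y) has_derivative (\<lambda>h. - \<phi>' y \<bullet> h)) (at y)" for y
    using has_derivative_minus[OF \<phi>(1)[of y]] by simp
  show "p \<in> subdiff u x"
    unfolding subdiff_def mem_Collect_eq
  proof (intro exI conjI)
    show "\<forall>y. ((\<lambda>y. - \<phi> y) has_derivative (\<lambda>h. - \<phi>' y \<bullet> h)) (at y)" using deriv by blast
    show "\<forall>y. dist y x < e \<longrightarrow> - \<phi> y \<le> u y" using \<phi>(6) minus_le_iff by blast
  qed (use \<phi> q in \<open>auto intro!: continuous_intros\<close>)
qed

lemma has_derivative_quadratic:
  fixes x z p :: "'a::real_inner"
  shows "((\<lambda>z. p \<bullet> (z - x) + k * (norm (z - x))\<^sup>2) has_derivative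
    (\<lambda>h. (p + (2 * k) *\<^sub>R (z - x)) \<bullet> h)) (at z)"
  unfolding power2_norm_eq_inner
  by (auto intro!: derivative_eq_intros simp: algebra_simps inner_commute fun_eq_iff)

lemma superdiff_quadraticI:
  fixes u :: "real^'n \<Rightarrow> real"
  assumes "0 < e" and "\<And>z. dist z x < e \<Longrightarrow> u z \<le> u x + p \<bullet> (z - x) + k * (norm (z - x))\<^sup>2"
  shows "p \<in> superdiff u x"
proof -
  have "p + (2 * k) *\<^sub>R (x - x) \<in> superdiff u x"
    by (rule superdiff_touchI[OF has_derivative_quadratic[where x = x]])
      (use assms in \<open>auto intro!: continuous_intros simp: algebra_simps\<close>)
  then show ?thesis by simp
qed

lemma subdiff_quadraticI:
  fixes u :: "real^'n \<Rightarrow> real"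
  assumes "0 < e" and "\<And>z. dist z x < e \<Longrightarrow> u x + p \<bullet> (z - x) - k * (norm (z - x))\<^sup>2 \<le> u z"
  shows "p \<in> subdiff u x"
proof -
  have "- p \<in> superdiff (\<lambda>y. - u y) x"
    by (rule superdiff_quadraticI[OF assms(1), where k = k]) (use assms(2) in \<open>force simp: algebra_simps\<close>)
  then show ?thesis unfolding subdiff_eq_uminus_superdiff by force
qed

text \<open>Keeps only the first order expansion of the test function; the Lipschitz bound on
  momenta and the semiconcavity argument use nothing more.\<close>

lemma superdiff_le_linear:
  fixes u :: "real^'n \<Rightarrow> real"
  assumes "p \<in> superdiff u x" "0 < \<eta>"
  obtains d where "0 < d" "\<And>y. dist y x < d \<Longrightarrow> u y \<le> u x + p \<bullet> (y - x) + \<eta> * norm (y - x)"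
proof -
  from assms(1) obtain \<phi> \<phi>' e where \<phi>: "(\<phi> has_derivative (\<lambda>h. \<phi>' x \<bullet> h)) (at x)"
    "\<phi>' x = p" "\<phi> x = u x" "e > 0" "\<And>y. dist y x < e \<Longrightarrow> u y \<le> \<phi> y"
    unfolding superdiff_def by blast
  from \<phi>(1) assms(2) obtain d where d: "d > 0"
    "\<And>y. norm (y - x) < d \<Longrightarrow> norm (\<phi> y - \<phi> x - \<phi>' x \<bullet> (y - x)) \<le> \<eta> * norm (y - x)"
    unfolding has_derivative_at_alt by blast
  show ?thesis
  proof
    show "min d e > 0" using d \<phi> by simp
    fix y assume "dist y x < min d e"
    then show "u y \<le> u x + p \<bullet> (y - x) + \<eta> * norm (y - x)"
      using d(2)[of y] \<phi>(5)[of y] \<phi>(2,3) by (auto simp: dist_norm)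
  qed
qed

text \<open>Moving from \<open>x\<close> to \<open>x - s p\<close> makes \<open>u\<close> fall by at
  least about s |p|^2, whereas the Lipschitz bound allows a fall of at most L s |p|.\<close>

lemma superdiff_norm_le:
  fixes u :: "real^'n \<Rightarrow> real"
  assumes p: "p \<in> superdiff u x" and L: "L-lipschitz_on UNIV u"
  shows "norm p \<le> L"
proof (rule field_le_epsilon)
  fix \<eta> :: real assume \<eta>: "0 < \<eta>"
  obtain d where d: "0 < d" "\<And>y. dist y x < d \<Longrightarrow> u y \<le> u x + p \<bullet> (y - x) + \<eta> * norm (y - x)"
    using superdiff_le_linear[OF p \<eta>] by blast
  show "norm p \<le> L + \<eta>"
  proof (cases "p = 0")
    case True
    then show ?thesis using lipschitz_on_nonneg[OF L] \<eta> by simp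
  next
    case False
    define s where "s = d / (2 * norm p)"
    have s: "s > 0" "norm (s *\<^sub>R p) < d" using d False by (auto simp: s_def)
    have "u (x - s *\<^sub>R p) \<le> u x - p \<bullet> (s *\<^sub>R p) + \<eta> * norm (s *\<^sub>R p)"
      using d(2)[of "x - s *\<^sub>R p"] s by (simp add: dist_norm)
    moreover have "u x - u (x - s *\<^sub>R p) \<le> L * norm (s *\<^sub>R p)"
      using lipschitz_onD[OF L, of x "x - s *\<^sub>R p"] by (simp add: dist_norm)
    ultimately have "s * (norm p * norm p) \<le> s * ((L + \<eta>) * norm p)"
      using s(1) by (simp add: power2_norm_eq_inner[symmetric] power2_eq_square algebra_simps)
    then show ?thesis using s False by simp
  qed
qed

lemma superdiff_antimono:
  assumes "p \<in> superdiff w x" "\<And>y. u y \<le> w y" "u x = w x"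
  shows "p \<in> superdiff u x"
proof -
  from assms(1) obtain \<phi> \<phi>' e where \<phi>: "\<And>y. (\<phi> has_derivative (\<lambda>h. \<phi>' y \<bullet> h)) (at y)"
    "continuous_on UNIV \<phi>'" "\<phi>' x = p" "\<phi> x = w x" "e > 0" "\<And>y. dist y x < e \<Longrightarrow> w y \<le> \<phi> y"
    unfolding superdiff_def by blast
  have "u z - \<phi> z \<le> u x - \<phi> x" if "dist z x < e" for z
    using \<phi>(4) \<phi>(6)[OF that] assms(2)[of z] assms(3) by simp
  from superdiff_touchI[OF \<phi>(1,2,5) this] show ?thesis using \<phi>(3) by simp
qed

text \<open>A norm is touched from above by a paraboloid at every nonzero point, so it can be used in
  place of the smooth test functions required by \<^const>\<open>superdiff\<close>.\<close>
lemma norm_le_quadratic: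
  fixes v h :: "'a::real_inner"
  assumes "v \<noteq> 0"
  shows "norm (v + h) \<le> norm v + (v \<bullet> h) / norm v + (norm h)\<^sup>2 / (2 * norm v)"
proof -
  have "2 * norm v * norm (v + h) \<le> (norm v)\<^sup>2 + (norm (v + h))\<^sup>2"
    by (metis sum_squares_bound)
  also have "\<dots> = 2 * (norm v)\<^sup>2 + 2 * (v \<bullet> h) + (norm h)\<^sup>2"
    unfolding power2_norm_eq_inner by (simp add: algebra_simps inner_commute)
  finally have "norm (v + h) \<le> (2 * (norm v)\<^sup>2 + 2 * (v \<bullet> h) + (norm h)\<^sup>2) / (2 * norm v)"
    using assms by (simp add: field_simps)
  also have "\<dots> = norm v + (v \<bullet> h) / norm v + (norm h)\<^sup>2 / (2 * norm v)"
    using assms by (simp add: field_simps power2_eq_square)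
  finally show ?thesis .
qed

section \<open>Periodic functions: Lipschitz bounds and density of superdifferentials\<close>

lemma Zperiodic_translate_unit_cube:
  fixes x :: "real^'n"
  obtains k where "int_vec k" "x + k \<in> cbox 0 1"
proof
  show "int_vec (\<chi> l. - of_int \<lfloor>x $ l\<rfloor> :: real^'n)" by (simp add: int_vec_def)
  show "x + (\<chi> l. - of_int \<lfloor>x $ l\<rfloor>) \<in> cbox 0 1"
    by (auto simp: mem_box_cart; linarith)
qed

lemma Zperiodic_bounded:
  fixes u :: "real^'n \<Rightarrow> real"
  assumes "continuous_on UNIV u" "Zperiodic u"
  obtains B where "\<And>x. \<bar>u x\<bar> \<le> B"
proof -
  have "bounded (u ` cbox 0 1)"
    by (intro compact_imp_bounded compact_continuous_image continuous_on_subset[OF assms(1)]) auto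
  then obtain B where B: "\<And>x. x \<in> cbox 0 1 \<Longrightarrow> \<bar>u x\<bar> \<le> B" by (auto simp: bounded_iff)
  have "\<bar>u x\<bar> \<le> B" for x
    using Zperiodic_translate_unit_cube[of x] B assms(2) unfolding Zperiodic_def by metis
  then show thesis by (rule that)
qed

text \<open>Penalising by \<open>K |y - x|\<close> with \<open>K > L\<close>: a maximum away from \<open>x\<close> would produce a superdifferential
  of norm \<open>K\<close>.\<close>
lemma superdiff_bounded_imp_lipschitz:
  fixes u :: "real^'n \<Rightarrow> real"
  assumes cont: "continuous_on UNIV u" and bdd: "\<And>x. \<bar>u x\<bar> \<le> B"
    and L: "\<And>x p. p \<in> superdiff u x \<Longrightarrow> norm p \<le> L" and "0 \<le> L"
  shows "L-lipschitz_on UNIV u"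
proof -
  have main: "u y \<le> u x + K * norm (y - x)" if "K > L" for K x y
  proof -
    have K: "K > 0" using that \<open>0 \<le> L\<close> by simp
    define G where "G y = u y - K * norm (y - x)" for y
    \<comment> \<open>Beyond this radius the penalty exceeds 2B, the largest possible oscillation of
      \<open>u\<close>, so a maximum over the ball is a maximum over the whole space.\<close>
    define R where "R = 2 * B / K"
    have B: "B \<ge> 0" using bdd[of 0] by linarith
    have "R \<ge> 0" using B K by (simp add: R_def)
    then have "\<exists>y\<in>cball x R. \<forall>z\<in>cball x R. G z \<le> G y"
      unfolding G_def
      by (intro continuous_attains_sup) (auto intro!: continuous_intros continuous_on_subset[OF cont])
    then obtain y0 where y0: "y0 \<in> cball x R" "\<And>z. z \<in> cball x R \<Longrightarrow> G z \<le> G y0" by blast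
    have max: "G z \<le> G y0" for z
    proof (cases "z \<in> cball x R")
      case False
      then have "K * norm (z - x) > 2 * B"
        using K by (simp add: R_def field_simps dist_norm norm_minus_commute)
      then have "G z \<le> G x" using bdd[of z] bdd[of x] by (simp add: G_def abs_le_iff)
      then show ?thesis using y0(2)[of x] \<open>R \<ge> 0\<close> by simp
    qed (use y0 in auto)
    have "y0 = x"
    proof (rule ccontr)
      assume neq: "y0 \<noteq> x"
      define v where "v = y0 - x"
      have v: "v \<noteq> 0" using neq by (simp add: v_def)
      have "(K / norm v) *\<^sub>R v \<in> superdiff u y0"
      proof (rule superdiff_quadraticI[of 1 _ _ _ "K / (2 * norm v)"])
        fix z
        have "u z \<le> u y0 + K * (norm (v + (z - y0)) - norm v)"
          using max[of z] by (simp add: G_def v_def algebra_simps)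
        also have "\<dots> \<le> u y0 + K * ((v \<bullet> (z - y0)) / norm v + (norm (z - y0))\<^sup>2 / (2 * norm v))"
          using norm_le_quadratic[OF v, of "z - y0"] K by (intro add_left_mono mult_left_mono) auto
        finally show "u z \<le> u y0 + (K / norm v) *\<^sub>R v \<bullet> (z - y0) + K / (2 * norm v) * (norm (z - y0))\<^sup>2"
          by (simp add: distrib_left)
      qed simp
      from L[OF this] show False using v K that by simp
    qed
    then show ?thesis using max[of y] by (simp add: G_def)
  qed
  have "u y \<le> u x + L * norm (y - x)" for x y
  proof (rule field_le_epsilon)
    fix \<eta> :: real assume "0 < \<eta>"
    \<comment> \<open>The contradiction needs a slope strictly above \<open>L\<close>; the excess is
      scaled by the distance so that it costs at most \<eta>.\<close>
    have "u y \<le> u x + (L + \<eta> / (norm (y - x) + 1)) * norm (y - x)"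
      by (rule main) (use \<open>0 < \<eta>\<close> in \<open>auto intro!: divide_pos_pos add_nonneg_pos\<close>)
    also have "\<dots> \<le> u x + L * norm (y - x) + \<eta>"
    proof -
      have "\<eta> / (norm (y - x) + 1) * norm (y - x) \<le> \<eta> / (norm (y - x) + 1) * (norm (y - x) + 1)"
        using \<open>0 < \<eta>\<close> by (intro mult_left_mono) auto
      also have "\<dots> = \<eta>" by (simp add: add_nonneg_eq_0_iff)
      finally show ?thesis by (simp add: algebra_simps)
    qed
    finally show "u y \<le> u x + L * norm (y - x) + \<eta>" .
  qed
  then have "\<bar>u y - u x\<bar> \<le> L * norm (y - x)" for x y
    by (smt (verit) norm_minus_commute)
  then show ?thesis
    using \<open>0 \<le> L\<close> by (intro lipschitz_onI) (simp_all add: dist_norm)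
qed

text \<open>Subtracting a steep paraboloid centred at \<open>x\<close> pushes the maximum over the
  ball into its interior, where the paraboloid touches \<open>u\<close> from above.\<close>

lemma superdiff_dense:
  fixes u :: "real^'n \<Rightarrow> real"
  assumes cont: "continuous_on UNIV u" and "0 < \<delta>"
  obtains y p where "dist y x < \<delta>" "p \<in> superdiff u y"
proof -
  have "bounded (u ` cball x \<delta>)"
    by (intro compact_imp_bounded compact_continuous_image continuous_on_subset[OF cont]) auto
  then obtain B where B: "\<And>z. z \<in> cball x \<delta> \<Longrightarrow> \<bar>u z\<bar> \<le> B"
    unfolding bounded_iff by force
  \<comment> \<open>On the boundary sphere the penalty equals 2B + 1, more than \<open>u\<close> can
    gain over its value at the centre.\<close>
  define K where "K = (2 * B + 1) / \<delta>\<^sup>2"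
  define \<phi> where "\<phi> z = 0 \<bullet> (z - x) + K * (norm (z - x))\<^sup>2" for z
  have "\<exists>y\<in>cball x \<delta>. \<forall>z\<in>cball x \<delta>. u z - \<phi> z \<le> u y - \<phi> y"
    using \<open>0 < \<delta>\<close> unfolding \<phi>_def
    by (intro continuous_attains_sup) (auto intro!: continuous_intros continuous_on_subset[OF cont])
  then obtain y where y: "y \<in> cball x \<delta>" "\<And>z. z \<in> cball x \<delta> \<Longrightarrow> u z - \<phi> z \<le> u y - \<phi> y" by blast
  have less: "dist y x < \<delta>"
  proof (rule ccontr)
    assume "\<not> dist y x < \<delta>"
    then have "norm (y - x) = \<delta>" using y(1) by (simp add: dist_norm norm_minus_commute)
    then have "\<phi> y = 2 * B + 1" using \<open>0 < \<delta>\<close> by (simp add: \<phi>_def K_def)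
    then show False using y(2)[of x] \<open>0 < \<delta>\<close> B[of x] B[OF y(1)] by (simp add: \<phi>_def)
  qed
  have "0 + (2 * K) *\<^sub>R (y - x) \<in> superdiff u y"
  proof (rule superdiff_touchI[OF has_derivative_quadratic[where p = 0 and x = x and k = K]])
    show "0 < \<delta> - dist y x" using less by simp
    fix z assume "dist z y < \<delta> - dist y x"
    then have "z \<in> cball x \<delta>" by (simp add: dist_commute) (smt (verit) dist_triangle dist_commute)
    from y(2)[OF this]
    show "u z - (0 \<bullet> (z - x) + K * (norm (z - x))\<^sup>2) \<le> u y - (0 \<bullet> (y - x) + K * (norm (y - x))\<^sup>2)"
      by (simp add: \<phi>_def)
  qed (auto intro!: continuous_intros)
  with less show thesis by (rule that)
qed

lemma lipschitz_real_abs_le: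
  fixes u :: "'a::real_normed_vector \<Rightarrow> real"
  assumes "L-lipschitz_on UNIV u"
  shows "\<bar>u x - u y\<bar> \<le> L * norm (x - y)"
  using lipschitz_onD[OF assms, of x y] by (simp add: dist_norm)

section \<open>Semiconcavity with a modulus, and superdifferentials obtained from it\<close>

text \<open>Serves a functional that is periodic in one variable and penalised in the others: only
  positive values can be brought back to the compact set. That is enough, since the maximum over
  \<open>S\<close> is already positive and any larger value would be positive too.\<close>

lemma attains_sup_mod_compact:
  fixes F :: "'a::topological_space \<Rightarrow> real"
  assumes "continuous_on UNIV F" "compact S" "0 < F z0"
    and "\<And>z. 0 < F z \<Longrightarrow> \<exists>z'\<in>S. F z' = F z"
  shows "\<exists>z\<in>S. \<forall>z'. F z' \<le> F z"
proof -
  have "\<exists>z\<in>S. \<forall>z'\<in>S. F z' \<le> F z"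
    using assms by (intro continuous_attains_sup) (auto intro: continuous_on_subset)
  then obtain z where z: "z \<in> S" "\<And>z'. z' \<in> S \<Longrightarrow> F z' \<le> F z" by blast
  have "F z' \<le> F z" for z'
    using assms(3,4) z(2) by (metis linorder_not_le order_less_trans order_less_le_trans)
  with z(1) show ?thesis by blast
qed

text \<open>For l <= 1/2 the point lies between \<open>q\<close> and the midpoint, on which it has
  weight 2l, so it inherits that share of the gap; the other half follows by exchanging
  \<open>p\<close> and \<open>q\<close>. The factor l (1 - l) is the one in the semiconcavity
  inequality, so the gain remains comparable when \<open>l\<close> is close to 0 or 1.\<close>

lemma convex_midpoint_gap:
  fixes G :: "'a::real_vector \<Rightarrow> real"
  assumes conv: "convex_on UNIV G" and gap: "G ((1/2) *\<^sub>R (p + q)) \<le> (G p + G q) / 2 - \<delta>"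
    and l: "0 \<le> l" "l \<le> 1" and "0 \<le> \<delta>"
  shows "G (l *\<^sub>R p + (1 - l) *\<^sub>R q) \<le> l * G p + (1 - l) * G q - 2 * (l * (1 - l)) * \<delta>"
proof -
  have half: "G (l *\<^sub>R p + (1 - l) *\<^sub>R q) \<le> l * G p + (1 - l) * G q - 2 * l * \<delta>"
    if "0 \<le> l" "l \<le> 1/2" and gap: "G ((1/2) *\<^sub>R (p + q)) \<le> (G p + G q) / 2 - \<delta>" for l p q
  proof -
    define m where "m = (1/2) *\<^sub>R (p + q)"
    have eq: "l *\<^sub>R p + (1 - l) *\<^sub>R q = (1 - 2 * l) *\<^sub>R q + (2 * l) *\<^sub>R m"
      by (simp add: m_def algebra_simps) (simp flip: scaleR_add_left)
    have "G ((1 - 2 * l) *\<^sub>R q + (2 * l) *\<^sub>R m) \<le> (1 - 2 * l) * G q + (2 * l) * G m"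
      using convex_onD[OF conv, of "2 * l" q m] that by simp
    moreover have "(2 * l) * G m \<le> (2 * l) * ((G p + G q) / 2 - \<delta>)"
      using gap that unfolding m_def by (intro mult_left_mono) auto
    ultimately have "G (l *\<^sub>R p + (1 - l) *\<^sub>R q) \<le> (1 - 2 * l) * G q + (2 * l) * ((G p + G q) / 2 - \<delta>)"
      unfolding eq by linarith
    also have "\<dots> = l * G p + (1 - l) * G q - 2 * l * \<delta>" by (simp add: field_simps)
    finally show ?thesis .
  qed
  show ?thesis
  proof (cases "l \<le> 1/2")
    case True
    have "l * (1 - l) * \<delta> \<le> l * 1 * \<delta>"
      using l \<open>0 \<le> \<delta>\<close> by (intro mult_right_mono mult_left_mono) auto
    then show ?thesis using half[OF l(1) True gap] by simp
  next
    case False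
    have "2 * (l * (1 - l)) * \<delta> \<le> 2 * (1 * (1 - l)) * \<delta>"
      using l \<open>0 \<le> \<delta>\<close> by (intro mult_right_mono mult_left_mono) auto
    moreover have "G ((1 - l) *\<^sub>R q + (1 - (1 - l)) *\<^sub>R p)
        \<le> (1 - l) * G q + (1 - (1 - l)) * G p - 2 * (1 - l) * \<delta>"
      by (rule half) (use False l gap in \<open>auto simp: add.commute\<close>)
    ultimately show ?thesis by (simp add: add.commute)
  qed
qed

text \<open>The doubling of variables: \<open>a\<close>, \<open>a - v\<close> are the end points and \<open>a - (1 - l) v + d\<close> replaces the
  intermediate point. At a maximum of the penalised functional the gradients satisfy
  \<open>p\<^sub>c = l p\<^sub>a + (1 - l) p\<^sub>b\<close> and \<open>|p\<^sub>a - p\<^sub>b| \<ge> \<epsilon>\<close>, so that strict convexity of \<open>F\<close> contradicts the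
  sub- and supersolution inequalities once \<open>v\<close> and \<open>d\<close> are small; taking \<open>M\<close> large forces \<open>v\<close> to be
  small.\<close>
lemma strictly_convex_imp_semiconcave:
  fixes u :: "real^'n \<Rightarrow> real" and F :: "real^'n \<Rightarrow> real^'n \<Rightarrow> real"
  assumes per: "Zperiodic u" and lip: "L-lipschitz_on UNIV u"
    and sub: "\<And>x p. p \<in> superdiff u x \<Longrightarrow> F x p \<le> 0"
    and super: "\<And>x p. p \<in> subdiff u x \<Longrightarrow> 0 \<le> F x p"
    and conv: "\<And>x. convex_on UNIV (F x)"
    and Flip: "\<And>R. \<exists>C\<ge>0. \<forall>x\<in>cball 0 R. \<forall>y\<in>cball 0 R. \<forall>p\<in>cball 0 R. \<bar>F x p - F y p\<bar> \<le> C * norm (x - y)"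
    and strict: "\<And>R \<epsilon>. 0 < \<epsilon> \<Longrightarrow> \<exists>\<delta>>0. \<forall>x\<in>cball 0 R. \<forall>p\<in>cball 0 R. \<forall>q\<in>cball 0 R.
      \<epsilon> \<le> norm (p - q) \<longrightarrow> F x ((1/2) *\<^sub>R (p + q)) \<le> (F x p + F x q) / 2 - \<delta>"
    and "0 < \<epsilon>"
  shows "\<exists>M\<ge>0. \<forall>a b l. 0 < l \<longrightarrow> l < 1 \<longrightarrow>
    l * u a + (1 - l) * u b - u (l *\<^sub>R a + (1 - l) *\<^sub>R b) \<le> l * (1 - l) * (\<epsilon> * norm (a - b) + M * (norm (a - b))\<^sup>2)"
proof -
  have L: "0 \<le> L" using lipschitz_on_nonneg[OF lip] .
  note ulip = lipschitz_real_abs_le[OF lip]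
  have ucont: "continuous_on UNIV u" by (rule lipschitz_on_continuous_on[OF lip])
  obtain B where B: "\<And>x. \<bar>u x\<bar> \<le> B" using Zperiodic_bounded[OF ucont per] by blast
  obtain R0 where R0: "\<And>x. x \<in> cbox 0 (1::real^'n) \<Longrightarrow> norm x \<le> R0"
    using bounded_cbox[of 0 "1::real^'n"] unfolding bounded_iff by blast
  have "R0 \<ge> 0" using R0[of 0] by (simp add: mem_box_cart)
  \<comment> \<open>One radius for everything: the first point lies in the unit cube,
    \<open>v\<close> and \<open>d\<close> will have norm at most 1, and momenta in
    superdifferentials have norm at most \<open>L\<close>.\<close>
  define R where "R = R0 + 2 + L"
  obtain C where C: "0 \<le> C" "\<And>x y p. norm x \<le> R \<Longrightarrow> norm y \<le> R \<Longrightarrow> norm p \<le> R \<Longrightarrow> \<bar>F x p - F y p\<bar> \<le> C * norm (x - y)"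
    using Flip[of R] by auto
  obtain \<delta> where \<delta>: "0 < \<delta>" "\<And>x p q. norm x \<le> R \<Longrightarrow> norm p \<le> R \<Longrightarrow> norm q \<le> R \<Longrightarrow>
      \<epsilon> \<le> norm (p - q) \<Longrightarrow> F x ((1/2) *\<^sub>R (p + q)) \<le> (F x p + F x q) / 2 - \<delta>"
    using strict[OF \<open>0 < \<epsilon>\<close>, of R] by auto
  \<comment> \<open>Within distance \<open>r\<close> the variation of \<open>F\<close> in its first
    argument costs at most half of the convexity gap \<delta>.\<close>
  define r where "r = min 1 (\<delta> / (2 * (C + 1)))"
  have r: "0 < r" "r \<le> 1" using \<delta>(1) C(1) by (auto simp: r_def)
  have "C * r \<le> (C + 1) * r" using r by (simp add: distrib_right)
  also have "\<dots> \<le> (C + 1) * (\<delta> / (2 * (C + 1)))"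
    using C(1) by (intro mult_left_mono) (auto simp: r_def)
  also have "\<dots> = \<delta> / 2" using C(1) by (simp add: field_simps)
  finally have Cr: "C * r \<le> \<delta> / 2" .
  \<comment> \<open>Makes M s^2 exceed 2 L s + 1 as soon as s > r: the first term beats the
    Lipschitz bound on the three-point difference, the second leaves 1 for the error due to
    \<open>d\<close>.\<close>
  define M where "M = 2 * L / r + 1 / r\<^sup>2"
  have M: "0 < M" using L r by (simp add: M_def add_nonneg_pos)
  have Mr: "M * s\<^sup>2 > 2 * L * s + 1" if "s > r" for s
  proof -
    have "s\<^sup>2 > r * s" using that r by (simp add: power2_eq_square)
    then have "2 * L / r * s\<^sup>2 \<ge> 2 * L / r * (r * s)" using L r by (intro mult_left_mono) auto
    moreover have "1 / r\<^sup>2 * s\<^sup>2 > 1" using that r by (simp add: field_simps power_strict_mono)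
    moreover have "2 * L / r * (r * s) = 2 * L * s" using r by simp
    moreover have "M * s\<^sup>2 = 2 * L / r * s\<^sup>2 + 1 / r\<^sup>2 * s\<^sup>2" unfolding M_def by (rule distrib_right)
    ultimately show ?thesis by linarith
  qed
  define g where "g v = \<epsilon> * norm v + M * (norm v)\<^sup>2" for v :: "real^'n"
  have "l * u a + (1 - l) * u b - u (l *\<^sub>R a + (1 - l) *\<^sub>R b) \<le> l * (1 - l) * g (a - b)"
    if l: "0 < l" "l < 1" for a b l
  proof (rule ccontr)
    assume neg: "\<not> ?thesis"
    define \<mu> where "\<mu> = l * (1 - l)"
    have \<mu>: "0 < \<mu>" using l by (simp add: \<mu>_def)
    define \<kappa> where "\<kappa> = l * u a + (1 - l) * u b - u (l *\<^sub>R a + (1 - l) *\<^sub>R b) - \<mu> * g (a - b)"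
    have \<kappa>: "0 < \<kappa>" using neg by (simp add: \<kappa>_def \<mu>_def)
    \<comment> \<open>Unlike \<open>M\<close>, this constant may depend on the points and on
      \<open>l\<close>, because it does not enter the conclusion. The summands after the 1 provide,
      in varied order, the four smallness conditions \<open>LT\<close> on the displacement
      \<open>d\<close>.\<close>
    define T where "T = 1 + L + L\<^sup>2 / \<kappa> + 2 * C * L / (\<mu> * \<delta>) + L\<^sup>2 / \<mu>"
    have T: "0 < T" "L \<le> T" "L\<^sup>2 / \<kappa> < T" "2 * C * L / (\<mu> * \<delta>) \<le> T" "L\<^sup>2 / \<mu> \<le> T"
      using L C(1) \<kappa> \<mu> \<delta>(1) by (simp_all add: T_def add_pos_nonneg)
    have LT: "L / T \<le> 1" "L * (L / T) < \<kappa>" "C * (L / T) \<le> \<mu> * \<delta> / 2" "L * (L / T) \<le> \<mu>"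
      using T \<kappa> \<mu> \<delta>(1) by (simp_all add: field_simps power2_eq_square)
    \<comment> \<open>In the coordinates \<open>(a, v, d)\<close> integer translations act on
      \<open>a\<close> alone, while the penalties bound \<open>v\<close> and \<open>d\<close>; this
      yields compactness.\<close>
    define \<Phi> where "\<Phi> = (\<lambda>(a, v, d). l * u a + (1 - l) * u (a - v) - u (a - (1 - l) *\<^sub>R v + d)
        - \<mu> * g v - T * (norm d)\<^sup>2)"
    \<comment> \<open>The maximum with 1 lets a bound on the square of a norm serve as a bound on
      the norm itself.\<close>
    define Q where "Q = max 1 (max (2 * B / (\<mu> * M)) (2 * B / T))"
    have pos: "\<Phi> (a, a - b, 0) = \<kappa>"
      by (simp add: \<Phi>_def \<kappa>_def algebra_simps)
    have "\<exists>z\<in>cbox 0 1 \<times> (cball 0 Q \<times> cball 0 Q). \<forall>z'. \<Phi> z' \<le> \<Phi> z"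
    proof (rule attains_sup_mod_compact)
      have u_comp: "continuous_on UNIV (\<lambda>x::(real^'n) \<times> (real^'n) \<times> (real^'n). u (f x))" if "continuous_on UNIV f" for f
        using continuous_on_compose2[OF ucont that] by simp
      show "continuous_on UNIV \<Phi>"
        unfolding \<Phi>_def g_def case_prod_unfold by (intro continuous_intros u_comp)
      show "0 < \<Phi> (a, a - b, 0)" using pos \<kappa> by simp
      show "compact (cbox 0 (1::real^'n) \<times> (cball (0::real^'n) Q \<times> cball (0::real^'n) Q))"
        by (intro compact_Times compact_cbox compact_cball)
      fix z :: "(real^'n) \<times> (real^'n) \<times> (real^'n)" assume z: "0 < \<Phi> z"
      obtain a' v d where [simp]: "z = (a', v, d)" by (cases z)
      obtain k where k: "int_vec k" "a' + k \<in> cbox 0 1" using Zperiodic_translate_unit_cube by blast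
      have uk: "u (x + k) = u x" for x using per k(1) by (simp add: Zperiodic_def)
      have \<Phi>k: "\<Phi> (a' + k, v, d) = \<Phi> z"
        using uk[of a'] uk[of "a' - v"] uk[of "a' - (1 - l) *\<^sub>R v + d"] by (simp add: \<Phi>_def algebra_simps)
      have "l * u a' + (1 - l) * u (a' - v) \<le> l * B + (1 - l) * B"
        using B l by (intro add_mono mult_left_mono) (auto simp: abs_le_iff)
      moreover have "- u (a' - (1 - l) *\<^sub>R v + d) \<le> B" using B by (simp add: abs_le_iff)
      ultimately have 2: "\<mu> * g v + T * (norm d)\<^sup>2 < 2 * B"
        using z by (simp add: \<Phi>_def algebra_simps)
      have "0 \<le> g v" using \<open>0 < \<epsilon>\<close> M by (simp add: g_def)
      have "Q \<ge> 1" by (simp add: Q_def)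
      have le_Q: "s \<le> Q" if "K * s\<^sup>2 < 2 * B" "0 < K" "2 * B / K \<le> Q" "0 \<le> s" for s K
      proof (rule ccontr)
        assume "\<not> s \<le> Q"
        then have "Q \<le> s" "1 \<le> s" using \<open>Q \<ge> 1\<close> by auto
        then have "Q \<le> s\<^sup>2" using mult_mono[of Q s 1 s] \<open>Q \<ge> 1\<close> by (simp add: power2_eq_square)
        then have "K * (2 * B / K) \<le> K * s\<^sup>2" using that(2,3) by (intro mult_left_mono) auto
        then show False using that by simp
      qed
      have "norm v \<le> Q"
      proof (rule le_Q)
        have "\<mu> * (M * (norm v)\<^sup>2) \<le> \<mu> * g v" using \<mu> \<open>0 < \<epsilon>\<close> by (intro mult_left_mono) (auto simp: g_def)
        moreover have "0 \<le> T * (norm d)\<^sup>2" using T(1) by simp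
        ultimately show "(\<mu> * M) * (norm v)\<^sup>2 < 2 * B" unfolding mult.assoc using 2 by linarith
      qed (use \<mu> M in \<open>auto simp: Q_def\<close>)
      moreover have "norm d \<le> Q"
      proof (rule le_Q)
        show "T * (norm d)\<^sup>2 < 2 * B" using 2 \<mu> \<open>0 \<le> g v\<close> mult_nonneg_nonneg[of \<mu> "g v"] by linarith
      qed (use T in \<open>auto simp: Q_def\<close>)
      ultimately show "\<exists>z'\<in>cbox 0 1 \<times> (cball 0 Q \<times> cball 0 Q). \<Phi> z' = \<Phi> z"
        using k(2) \<Phi>k by (intro bexI[of _ "(a' + k, v, d)"]) auto
    qed
    then obtain z where z: "z \<in> cbox 0 1 \<times> (cball 0 Q \<times> cball 0 Q)" "\<And>z'. \<Phi> z' \<le> \<Phi> z" by blast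
    obtain a0 v d where zeq: "z = (a0, v, d)" by (cases z)
    define b0 where "b0 = a0 - v"
    define c0 where "c0 = a0 - (1 - l) *\<^sub>R v + d"
    define V where "V = \<Phi> z"
    have V: "V = l * u a0 + (1 - l) * u b0 - u c0 - \<mu> * g v - T * (norm d)\<^sup>2"
      by (simp add: V_def zeq \<Phi>_def b0_def c0_def)
    have max: "l * u a' + (1 - l) * u b' - u c' - \<mu> * g (a' - b') - T * (norm (c' - l *\<^sub>R a' - (1 - l) *\<^sub>R b'))\<^sup>2 \<le> V"
      for a' b' c'
    proof -
      have "\<Phi> (a', a' - b', c' - l *\<^sub>R a' - (1 - l) *\<^sub>R b') \<le> V" unfolding V_def by (rule z(2))
      moreover have "a' - (1 - l) *\<^sub>R (a' - b') + (c' - l *\<^sub>R a' - (1 - l) *\<^sub>R b') = c'"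
        by (simp add: algebra_simps)
      ultimately show ?thesis by (simp add: \<Phi>_def)
    qed
    have d_eq: "d = c0 - l *\<^sub>R a0 - (1 - l) *\<^sub>R b0" and v_eq: "v = a0 - b0"
      by (simp_all add: c0_def b0_def algebra_simps)
    have "\<kappa> \<le> V" using z(2)[of "(a, a - b, 0)"] pos by (simp add: V_def)
    \<comment> \<open>Comparison with \<open>d = 0\<close>, that is, with the exact intermediate
      point \<open>c0 - d\<close>.\<close>
    have nd: "norm d \<le> L / T"
    proof -
      have "T * (norm d)\<^sup>2 \<le> L * norm d"
        using max[of a0 b0 "c0 - d"] ulip[of "c0 - d" c0] V
        by (simp add: v_eq[symmetric] abs_le_iff) (simp add: d_eq abs_le_iff)
      then have "norm d * (T * norm d) \<le> norm d * L" by (simp add: power2_eq_square algebra_simps)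
      then show ?thesis using T(1) L by (cases "d = 0") (simp_all add: field_simps)
    qed
    \<comment> \<open>The term \<epsilon> |v| has no paraboloid above it at the origin. If
      \<open>v = 0\<close>, however, the maximum would be at most L |d|, hence below
      \<kappa>.\<close>
    have "v \<noteq> 0"
    proof
      assume "v = 0"
      then have "V = u a0 - u (a0 + d) - T * (norm d)\<^sup>2"
        unfolding V b0_def c0_def by (simp add: g_def algebra_simps)
      also have "\<dots> \<le> L * norm d"
      proof -
        have "u a0 - u (a0 + d) \<le> L * norm d" using ulip[of a0 "a0 + d"] by (simp add: abs_le_iff)
        moreover have "0 \<le> T * (norm d)\<^sup>2" using T(1) by simp
        ultimately show ?thesis by linarith
      qed
      also have "\<dots> \<le> L * (L / T)" using nd L by (rule mult_left_mono)
      finally show False using \<open>\<kappa> \<le> V\<close> LT(2) by simp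
    qed
    have ac: "norm (a0 - c0) \<le> (1 - l) * norm v + norm d"
      using norm_triangle_ineq4[of "(1 - l) *\<^sub>R v" d] l by (simp add: c0_def)
    have bc: "norm (b0 - c0) \<le> l * norm v + norm d"
    proof -
      have "b0 - c0 = - (l *\<^sub>R v) - d" by (simp add: c0_def b0_def algebra_simps)
      then show ?thesis using norm_triangle_ineq4[of "- (l *\<^sub>R v)" d] l by simp
    qed
    \<comment> \<open>The weighted distance carries the factor \<mu> that also multiplies the
      convexity gain; bounding it simply by |v| would fail for \<open>l\<close> close to 0 or
      1.\<close>
    have abc: "l * norm (a0 - c0) + (1 - l) * norm (b0 - c0) \<le> 2 * \<mu> * norm v + norm d"
    proof -
      have "l * norm (a0 - c0) + (1 - l) * norm (b0 - c0)
          \<le> l * ((1 - l) * norm v + norm d) + (1 - l) * (l * norm v + norm d)"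
        using ac bc l by (intro add_mono mult_left_mono) auto
      also have "\<dots> = 2 * \<mu> * norm v + norm d" by (simp add: \<mu>_def algebra_simps)
      finally show ?thesis .
    qed
    \<comment> \<open>Positivity of the maximum forces the three-point difference above \<mu> M
      |v|^2, while the Lipschitz bound keeps it at most \<mu> (2 L |v| + 1).\<close>
    have nv: "norm v \<le> r"
    proof (rule ccontr)
      assume "\<not> norm v \<le> r"
      then have "\<mu> * (2 * L * norm v + 1) < \<mu> * (M * (norm v)\<^sup>2)"
        using Mr \<mu> by (intro mult_strict_left_mono) auto
      also have "\<dots> \<le> \<mu> * g v" using \<mu> \<open>0 < \<epsilon>\<close> by (intro mult_left_mono) (auto simp: g_def)
      also have "\<dots> \<le> l * (u a0 - u c0) + (1 - l) * (u b0 - u c0)"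
      proof -
        have "0 \<le> T * (norm d)\<^sup>2" using T(1) by simp
        moreover have "l * (u a0 - u c0) + (1 - l) * (u b0 - u c0) = l * u a0 + (1 - l) * u b0 - u c0"
          by (simp add: algebra_simps)
        ultimately show ?thesis using V \<open>\<kappa> \<le> V\<close> \<kappa> by linarith
      qed
      also have "\<dots> \<le> l * (L * norm (a0 - c0)) + (1 - l) * (L * norm (b0 - c0))"
        using ulip l by (intro add_mono mult_left_mono) (auto simp: abs_le_iff)
      also have "\<dots> = L * (l * norm (a0 - c0) + (1 - l) * norm (b0 - c0))" by (simp add: algebra_simps)
      also have "\<dots> \<le> L * (2 * \<mu> * norm v + norm d)" using abc L by (rule mult_left_mono)
      also have "\<dots> \<le> L * (2 * \<mu> * norm v) + \<mu>"
        using LT(4) mult_left_mono[OF nd L] by (simp add: distrib_left)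
      finally show False by (simp add: algebra_simps)
    qed
    \<comment> \<open>The gradient of \<open>g\<close> at \<open>v\<close>; \<open>k\<close> is the
      curvature of a paraboloid lying above \<open>g\<close> and touching it there.\<close>
    define w where "w = (\<epsilon> / norm v + 2 * M) *\<^sub>R v"
    define k where "k = \<epsilon> / (2 * norm v) + M"
    have g_add: "g (v + h) - g v \<le> w \<bullet> h + k * (norm h)\<^sup>2" for h
    proof -
      have "\<epsilon> * norm (v + h) \<le> \<epsilon> * (norm v + (v \<bullet> h) / norm v + (norm h)\<^sup>2 / (2 * norm v))"
        using norm_le_quadratic[OF \<open>v \<noteq> 0\<close>] \<open>0 < \<epsilon>\<close> by (intro mult_left_mono) auto
      moreover have "(norm (v + h))\<^sup>2 = (norm v)\<^sup>2 + 2 * (v \<bullet> h) + (norm h)\<^sup>2"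
        unfolding power2_norm_eq_inner by (simp add: algebra_simps inner_commute)
      ultimately show ?thesis by (simp add: g_def w_def k_def algebra_simps)
    qed
    have sq: "(norm (d - s *\<^sub>R h))\<^sup>2 = (norm d)\<^sup>2 - 2 * s * (d \<bullet> h) + s\<^sup>2 * (norm h)\<^sup>2" for s h
      unfolding power2_norm_eq_inner by (simp add: algebra_simps inner_commute power2_eq_square)
    \<comment> \<open>Momenta read off by freezing two of the three points. The weight of the moving
      point is divided out, which turns \<mu> into \<open>1 - l\<close> and \<open>l\<close>
      respectively.\<close>
    define pa where "pa = (1 - l) *\<^sub>R w - (2 * T) *\<^sub>R d"
    define pb where "pb = - l *\<^sub>R w - (2 * T) *\<^sub>R d"
    define pc where "pc = - (2 * T) *\<^sub>R d"
    have pa: "pa \<in> superdiff u a0"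
    proof (rule superdiff_quadraticI[of 1 _ _ _ "(1 - l) * k + T * l"])
      fix y
      define h where "h = y - a0"
      have eqs: "y - b0 = v + h" "c0 - l *\<^sub>R y - (1 - l) *\<^sub>R b0 = d - l *\<^sub>R h"
        by (simp_all add: h_def v_eq d_eq algebra_simps)
      have "l * u y \<le> l * u a0 + \<mu> * (g (v + h) - g v) + T * ((norm (d - l *\<^sub>R h))\<^sup>2 - (norm d)\<^sup>2)"
        using max[of y b0 c0] unfolding V eqs by (simp add: algebra_simps)
      also have "\<dots> \<le> l * u a0 + \<mu> * (w \<bullet> h + k * (norm h)\<^sup>2) + T * ((norm (d - l *\<^sub>R h))\<^sup>2 - (norm d)\<^sup>2)"
        using g_add \<mu> by simp
      also have "\<dots> = l * (u a0 + pa \<bullet> h + ((1 - l) * k + T * l) * (norm h)\<^sup>2)"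
        unfolding sq \<mu>_def pa_def by (simp add: algebra_simps power2_eq_square)
      finally show "u y \<le> u a0 + pa \<bullet> (y - a0) + ((1 - l) * k + T * l) * (norm (y - a0))\<^sup>2"
        using l unfolding h_def by simp
    qed simp
    have pb: "pb \<in> superdiff u b0"
    proof (rule superdiff_quadraticI[of 1 _ _ _ "l * k + T * (1 - l)"])
      fix y
      define h where "h = y - b0"
      have eqs: "a0 - y = v + - h" "c0 - l *\<^sub>R a0 - (1 - l) *\<^sub>R y = d - (1 - l) *\<^sub>R h"
        by (simp_all add: h_def v_eq d_eq algebra_simps)
      have "(1 - l) * u y \<le> (1 - l) * u b0 + \<mu> * (g (v + - h) - g v) + T * ((norm (d - (1 - l) *\<^sub>R h))\<^sup>2 - (norm d)\<^sup>2)"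
        using max[of a0 y c0] unfolding V eqs by (simp add: algebra_simps)
      also have "\<dots> \<le> (1 - l) * u b0 + \<mu> * (w \<bullet> (- h) + k * (norm (- h))\<^sup>2) + T * ((norm (d - (1 - l) *\<^sub>R h))\<^sup>2 - (norm d)\<^sup>2)"
        using g_add[of "- h"] \<mu> by simp
      also have "\<dots> = (1 - l) * (u b0 + pb \<bullet> h + (l * k + T * (1 - l)) * (norm h)\<^sup>2)"
        unfolding sq \<mu>_def pb_def by (simp add: algebra_simps power2_eq_square)
      finally show "u y \<le> u b0 + pb \<bullet> (y - b0) + (l * k + T * (1 - l)) * (norm (y - b0))\<^sup>2"
        using l unfolding h_def by simp
    qed simp
    have pc: "pc \<in> subdiff u c0"
    proof (rule subdiff_quadraticI[of 1 _ _ _ T])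
      fix y
      define h where "h = y - c0"
      have eqs: "y - l *\<^sub>R a0 - (1 - l) *\<^sub>R b0 = d - (- 1) *\<^sub>R h"
        by (simp add: h_def d_eq algebra_simps)
      have "u c0 - T * ((norm (d - (- 1) *\<^sub>R h))\<^sup>2 - (norm d)\<^sup>2) \<le> u y"
        using max[of a0 b0 y] unfolding V eqs v_eq by (simp add: algebra_simps)
      then show "u c0 + pc \<bullet> (y - c0) - T * (norm (y - c0))\<^sup>2 \<le> u y"
        unfolding sq pc_def h_def[symmetric] by (simp add: algebra_simps)
    qed simp
    have a0R: "norm a0 \<le> R0" using z(1) R0 by (simp add: zeq)
    have nd1: "norm d \<le> 1" using nd LT(1) by simp
    have nv1: "norm v \<le> 1" using nv r by simp
    have nb0: "norm b0 \<le> R" using norm_triangle_ineq4[of a0 v] a0R nv1 L by (simp add: b0_def R_def)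
    have "(1 - l) * norm v \<le> 1 * 1" using nv1 l by (intro mult_mono) auto
    then have nc0: "norm c0 \<le> R"
      using norm_triangle_ineq2[of a0 "a0 - c0"] norm_triangle_ineq3[of a0 "a0 - c0"] norm_triangle_ineq4[of a0 "a0 - c0"] ac a0R nd1 L by (simp add: R_def)
    have na0: "norm a0 \<le> R" using a0R L by (simp add: R_def)
    have npa: "norm pa \<le> R" using superdiff_norm_le[OF pa lip] \<open>R0 \<ge> 0\<close> by (simp add: R_def)
    have npb: "norm pb \<le> R" using superdiff_norm_le[OF pb lip] \<open>R0 \<ge> 0\<close> by (simp add: R_def)
    have "pa - pb = w" by (simp add: pa_def pb_def algebra_simps)
    moreover have "norm w = \<epsilon> + 2 * M * norm v"
      using \<open>v \<noteq> 0\<close> \<open>0 < \<epsilon>\<close> M by (simp add: w_def field_simps)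
    ultimately have pab: "\<epsilon> \<le> norm (pa - pb)" using M by simp
    have pc_eq: "pc = l *\<^sub>R pa + (1 - l) *\<^sub>R pb"
      by (simp add: pa_def pb_def pc_def algebra_simps)
    \<comment> \<open>Balance: convexity gains 2 \<mu> \<delta>; moving \<open>F\<close> from the
      end points to \<open>c0\<close> costs at most \<mu> \<delta> through \<open>v\<close> and half
      of \<mu> \<delta> through \<open>d\<close>.\<close>
    have "0 \<le> F c0 pc" using super[OF pc] .
    also have "\<dots> \<le> l * F c0 pa + (1 - l) * F c0 pb - 2 * \<mu> * \<delta>"
      unfolding pc_eq \<mu>_def
      using convex_midpoint_gap[of "F c0" pa pb \<delta> l, OF conv \<delta>(2)[OF nc0 npa npb pab]] l \<delta>(1) by simp
    also have "\<dots> \<le> l * (C * norm (a0 - c0)) + (1 - l) * (C * norm (b0 - c0)) - 2 * \<mu> * \<delta>"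
    proof -
      have "F c0 pa \<le> C * norm (a0 - c0)"
        using C(2)[OF na0 nc0 npa] sub[OF pa] by linarith
      moreover have "F c0 pb \<le> C * norm (b0 - c0)"
        using C(2)[OF nb0 nc0 npb] sub[OF pb] by linarith
      ultimately show ?thesis using l by (intro diff_right_mono add_mono mult_left_mono) auto
    qed
    also have "\<dots> = C * (l * norm (a0 - c0) + (1 - l) * norm (b0 - c0)) - 2 * \<mu> * \<delta>"
      by (simp add: algebra_simps)
    also have "\<dots> \<le> C * (2 * \<mu> * norm v + norm d) - 2 * \<mu> * \<delta>"
      using abc C(1) by (intro diff_right_mono mult_left_mono)
    also have "\<dots> = 2 * \<mu> * (C * norm v) + C * norm d - 2 * \<mu> * \<delta>" by (simp add: algebra_simps)
    also have "\<dots> \<le> 2 * \<mu> * (\<delta> / 2) + \<mu> * \<delta> / 2 - 2 * \<mu> * \<delta>"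
    proof -
      have "C * norm v \<le> \<delta> / 2" using Cr mult_left_mono[OF nv C(1)] by simp
      then have "2 * \<mu> * (C * norm v) \<le> 2 * \<mu> * (\<delta> / 2)" using \<mu> by (intro mult_left_mono) auto
      moreover have "C * norm d \<le> \<mu> * \<delta> / 2" using LT(3) mult_left_mono[OF nd C(1)] by linarith
      ultimately show ?thesis by linarith
    qed
    also have "\<dots> < 0" using \<mu> \<delta>(1) by simp
    finally show False by simp
  qed
  then show ?thesis using M unfolding g_def by (intro exI[of _ M]) auto
qed

text \<open>A modulus \<open>W(r) = inf (\<epsilon> + M\<^sub>\<epsilon> r)\<close> is concave, hence continuous, and \<open>\<psi>(h) = \<integral>\<^sub>0\<^bsup>|h|\<^esup> 2 W(2s) ds\<close> is a
  continuously differentiable majorant of \<open>|h| W(|h|)\<close>.\<close>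
lemma superdiff_modulusI:
  fixes u :: "real^'n \<Rightarrow> real"
  assumes mod: "\<And>\<epsilon>. 0 < \<epsilon> \<Longrightarrow> 0 \<le> M \<epsilon>"
    and bound: "\<And>z \<epsilon>. 0 < \<epsilon> \<Longrightarrow> u z \<le> u x + p \<bullet> (z - x) + \<epsilon> * norm (z - x) + M \<epsilon> * (norm (z - x))\<^sup>2"
  shows "p \<in> superdiff u x"
proof -
  define W where "W r = (INF \<epsilon>\<in>{0<..}. \<epsilon> + M \<epsilon> * r)" for r :: real
  have bdd: "bdd_below ((\<lambda>\<epsilon>. \<epsilon> + M \<epsilon> * r) ` {0<..})" if "0 \<le> r" for r
    using mod that by (intro bdd_belowI[of _ 0]) (auto intro!: add_nonneg_nonneg)
  have W_le: "W r \<le> \<epsilon> + M \<epsilon> * r" if "0 \<le> r" "0 < \<epsilon>" for r \<epsilon>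
    unfolding W_def using that by (intro cINF_lower bdd) auto
  have W_ge: "b \<le> W r" if "\<And>\<epsilon>. 0 < \<epsilon> \<Longrightarrow> b \<le> \<epsilon> + M \<epsilon> * r" for b r
    unfolding W_def using that by (intro cINF_greatest) auto
  have W_nonneg: "0 \<le> W r" if "0 \<le> r" for r
    using that mod by (intro W_ge add_nonneg_nonneg) auto
  have W_mono: "W r \<le> W s" if "0 \<le> r" "r \<le> s" for r s
  proof (rule W_ge)
    fix \<epsilon> :: real assume "0 < \<epsilon>"
    then show "W r \<le> \<epsilon> + M \<epsilon> * s"
      using W_le[OF that(1), of \<epsilon>] mult_left_mono[OF that(2) mod] by fastforce
  qed
  \<comment> \<open>An infimum of affine functions is concave. Concavity gives continuity in the
    open half-line; continuity at 0 is obtained separately in \<open>w_small\<close>.\<close>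
  have "convex_on {0<..} (\<lambda>r. - W r)"
  proof (rule convex_onI)
    fix t r s :: real assume *: "0 < t" "t < 1" "r \<in> {0<..}" "s \<in> {0<..}"
    have "(1 - t) * W r + t * W s \<le> W ((1 - t) * r + t * s)"
    proof (rule W_ge)
      fix \<epsilon> :: real assume "0 < \<epsilon>"
      then have "(1 - t) * W r + t * W s \<le> (1 - t) * (\<epsilon> + M \<epsilon> * r) + t * (\<epsilon> + M \<epsilon> * s)"
        using * by (intro add_mono mult_left_mono W_le) auto
      then show "(1 - t) * W r + t * W s \<le> \<epsilon> + M \<epsilon> * ((1 - t) * r + t * s)"
        by (simp add: algebra_simps)
    qed
    then show "- W ((1 - t) *\<^sub>R r + t *\<^sub>R s) \<le> (1 - t) * - W r + t * - W s" by simp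
  qed simp
  then have "continuous_on {0<..} (\<lambda>r. - (- W r))"
    by (intro continuous_on_minus convex_on_continuous) auto
  then have contW: "continuous_on {0<..} W" by simp
  \<comment> \<open>Both factors 2 serve \<open>P_ge\<close>: on [r/2, r] this function is at least
    2 W(r), so that half of the interval alone contributes r W(r) to the integral.\<close>
  define w where "w s = 2 * W (2 * s)" for s
  have w_nonneg: "0 \<le> w s" if "0 \<le> s" for s using W_nonneg[of "2 * s"] that by (simp add: w_def)
  have w_mono: "w s \<le> w t" if "0 \<le> s" "s \<le> t" for s t using W_mono[of "2 * s" "2 * t"] that by (simp add: w_def)
  have w_small: "\<exists>d>0. \<forall>s. 0 \<le> s \<and> s < d \<longrightarrow> w s < \<eta>" if "0 < \<eta>" for \<eta>
  proof -
    define d where "d = \<eta> / (8 * (M (\<eta> / 8) + 1))"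
    have m: "0 \<le> M (\<eta> / 8)" using mod that by simp
    have d: "d > 0" using m that by (simp add: d_def)
    have "w s < \<eta>" if s: "0 \<le> s" "s < d" for s
    proof -
      have "M (\<eta> / 8) * s \<le> (M (\<eta> / 8) + 1) * d" using m s by (intro mult_mono) auto
      also have "\<dots> = \<eta> / 8" using m by (simp add: d_def field_simps)
      finally have "4 * (M (\<eta> / 8) * s) \<le> \<eta> / 2" by simp
      then show ?thesis using W_le[of "2 * s" "\<eta> / 8"] s \<open>0 < \<eta>\<close> by (simp add: w_def)
    qed
    with d show ?thesis by blast
  qed
  have w0: "w 0 = 0"
    using w_small w_nonneg[of 0] by (metis order_refl order_less_le order_less_irrefl)
  have w_cont_pos: "isCont w s" if "0 < s" for s
  proof -
    have "isCont W (2 * s)" using contW that by (simp add: continuous_on_eq_continuous_at)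
    then show ?thesis unfolding w_def using isCont_o2[where f = "\<lambda>s. 2 * s" and g = W] by (intro continuous_intros) auto
  qed
  have w_tendsto: "((\<lambda>h. w (norm h)) \<longlongrightarrow> 0) (at (0::real^'n))"
  proof (rule tendstoI)
    fix \<eta> :: real assume "0 < \<eta>"
    with w_small obtain d where "d > 0" "\<And>s. 0 \<le> s \<and> s < d \<Longrightarrow> w s < \<eta>" by blast
    then show "\<forall>\<^sub>F h in at (0::real^'n). dist (w (norm h)) 0 < \<eta>"
      unfolding eventually_at using w_nonneg by (intro exI[of _ d]) auto
  qed
  have w_cont: "continuous_on {0..} w"
    unfolding continuous_on_eq_continuous_within
  proof
    fix s :: real assume "s \<in> {0..}"
    show "continuous (at s within {0..}) w"
    proof (cases "s = 0")
      case True
      show ?thesis unfolding True continuous_within w0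
      proof (rule tendstoI)
        fix \<eta> :: real assume "0 < \<eta>"
        with w_small obtain d where "d > 0" "\<And>s. 0 \<le> s \<and> s < d \<Longrightarrow> w s < \<eta>" by blast
        then show "\<forall>\<^sub>F s in at 0 within {0..}. dist (w s) 0 < \<eta>"
          unfolding eventually_at using w_nonneg by (intro exI[of _ d]) auto
      qed
    qed (use w_cont_pos \<open>s \<in> {0..}\<close> in \<open>auto intro: continuous_at_imp_continuous_within\<close>)
  qed
  define P where "P r = integral {0..r} w" for r
  have w_int: "w integrable_on {a..b}" if "0 \<le> a" for a b
    using that by (intro integrable_continuous_real continuous_on_subset[OF w_cont]) auto
  have P_deriv: "(P has_real_derivative w r) (at r)" if "0 < r" for r
  proof -
    have "(P has_real_derivative w r) (at r within {0..r + 1})"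
      unfolding P_def using that
      by (intro integral_has_real_derivative continuous_on_subset[OF w_cont]) auto
    then show ?thesis using that at_within_Icc_at[of 0 r "r + 1"] by simp
  qed
  have P_le: "P r \<le> r * w r" if "0 \<le> r" for r
    using integral_le[of w "{0..r}" "\<lambda>_. w r"] w_int[of 0 r] w_mono that by (auto simp: P_def)
  have P_nonneg: "0 \<le> P r" for r
    unfolding P_def using w_nonneg by (intro integral_nonneg w_int) auto
  have P_ge: "r * W r \<le> P r" if "0 \<le> r" for r
  proof -
    have "integral {r/2..r} (\<lambda>_. 2 * W r) \<le> integral {r/2..r} w"
      using that W_mono[of r] by (intro integral_le w_int) (auto simp: w_def)
    moreover have "integral {0..r/2} w + integral {r/2..r} w = integral {0..r} w"
      using that by (intro Henstock_Kurzweil_Integration.integral_combine w_int) auto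
    moreover have "0 \<le> integral {0..r/2} w" using w_nonneg by (intro integral_nonneg w_int) auto
    ultimately show ?thesis using that by (simp add: P_def)
  qed
  define \<psi>' where "\<psi>' h = (w (norm h) / norm h) *\<^sub>R h" for h :: "real^'n"
  have norm_\<psi>': "norm (\<psi>' h) = w (norm h)" for h
    using w0 w_nonneg by (simp add: \<psi>'_def)
  have deriv: "((\<lambda>h. P (norm h)) has_derivative (\<lambda>k. \<psi>' h \<bullet> k)) (at h)" for h
  proof (cases "h = 0")
    case False
    then have "((\<lambda>h. P (norm h)) has_derivative (\<lambda>k. w (norm h) * (k \<bullet> sgn h))) (at h)"
      using P_deriv[of "norm h"] has_derivative_norm[of h]
        has_derivative_compose[of norm "\<lambda>k. k \<bullet> sgn h" h UNIV P "\<lambda>x. w (norm h) * x"]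
      by (simp add: has_field_derivative_def)
    then show ?thesis by (simp add: \<psi>'_def sgn_div_norm inner_commute divide_inverse mult.assoc)
  next
    case True
    \<comment> \<open>At the origin the norm is not differentiable, but P(|h|) <= |h| w(|h|) =
      o(|h|).\<close>
    have "norm (P (norm h) - P (norm 0) - 0) \<le> w (norm h) * norm h" for h :: "real^'n"
      using P_le[of "norm h"] P_nonneg[of "norm h"] P_le[of 0] P_nonneg[of 0] by (simp add: mult.commute)
    moreover have "\<exists>d>0. \<forall>h::real^'n. norm (h - 0) < d \<longrightarrow> w (norm h) * norm h \<le> \<eta> * norm (h - 0)" if "0 < \<eta>" for \<eta>
    proof -
      from w_small[OF that] obtain d where "d > 0" "\<And>s. 0 \<le> s \<and> s < d \<Longrightarrow> w s < \<eta>" by blast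
      then show ?thesis
        by (intro exI[of _ d]) (simp add: less_imp_le mult_right_mono)
    qed
    ultimately have "\<forall>\<eta>>0. \<exists>d>0. \<forall>h::real^'n. norm (h - 0) < d \<longrightarrow> norm (P (norm h) - P (norm 0) - 0) \<le> \<eta> * norm (h - 0)"
      by (meson order_trans)
    then have "((\<lambda>h::real^'n. P (norm h)) has_derivative (\<lambda>k. 0)) (at 0)"
      unfolding has_derivative_at_alt by simp
    then show ?thesis using True by (simp add: \<psi>'_def)
  qed
  have cont_\<psi>': "isCont \<psi>' h" for h
  proof (cases "h = 0")
    case False
    have "isCont (\<lambda>h. w (norm h)) h"
      by (rule isCont_o2[OF isCont_norm[OF continuous_ident] w_cont_pos]) (use False in simp)
    then show ?thesis unfolding \<psi>'_def using False by (intro continuous_intros) auto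
  next
    case True
    have "(\<psi>' \<longlongrightarrow> 0) (at 0)"
      by (rule tendsto_norm_zero_cancel) (use w_tendsto in \<open>simp add: norm_\<psi>'\<close>)
    then show ?thesis using True by (simp add: isCont_def \<psi>'_def)
  qed
  have comp: "((\<lambda>z. p \<bullet> z + P (norm (z - x))) has_derivative (\<lambda>k. (p + \<psi>' (z - x)) \<bullet> k)) (at z)" for z
  proof -
    have "((\<lambda>z. P (norm (z - x))) has_derivative (\<lambda>k. \<psi>' (z - x) \<bullet> k)) (at z)"
      using has_derivative_compose[OF _ deriv, of "\<lambda>z. z - x" "\<lambda>k. k" z UNIV]
        has_derivative_diff[OF has_derivative_ident has_derivative_const[of x], of "at z"] by simp
    from has_derivative_add[OF has_derivative_inner_right[OF has_derivative_ident] this, of p]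
    show ?thesis by (simp add: inner_add_left)
  qed
  have cont': "continuous_on UNIV (\<lambda>z. p + \<psi>' (z - x))"
  proof -
    have "continuous_on UNIV \<psi>'" using cont_\<psi>' by (simp add: continuous_at_imp_continuous_on)
    from continuous_on_compose2[OF this, of UNIV "\<lambda>z. z - x"] show ?thesis
      by (simp add: continuous_on_add continuous_on_diff)
  qed
  have "p + \<psi>' (x - x) \<in> superdiff u x"
  proof (rule superdiff_touchI[OF comp cont' zero_less_one])
    fix z
    define h where "h = norm (z - x)"
    have "h \<ge> 0" by (simp add: h_def)
    have "u z - u x - p \<bullet> (z - x) \<le> h * W h"
    proof (cases "h = 0")
      case True
      then show ?thesis by (simp add: h_def)
    next
      case False
      have "(u z - u x - p \<bullet> (z - x)) / h \<le> W h"
      proof (rule W_ge)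
        fix \<epsilon> :: real assume "0 < \<epsilon>"
        from bound[OF this, of z] show "(u z - u x - p \<bullet> (z - x)) / h \<le> \<epsilon> + M \<epsilon> * h"
          using False \<open>h \<ge> 0\<close> unfolding h_def[symmetric] by (simp add: field_simps power2_eq_square)
      qed
      then show ?thesis using False \<open>h \<ge> 0\<close> by (simp add: field_simps)
    qed
    also have "\<dots> \<le> P h" using P_ge \<open>h \<ge> 0\<close> .
    finally show "u z - (p \<bullet> z + P (norm (z - x))) \<le> u x - (p \<bullet> x + P (norm (x - x)))"
      using P_le[of 0] P_nonneg[of 0] by (simp add: h_def inner_diff_right)
  qed
  then show ?thesis by (simp add: \<psi>'_def)
qed

text \<open>The expansion at a point of superdifferentiability is extended to all \<open>z\<close>
  with constants that do not depend on the point. The momenta are bounded by \<open>L\<close>, so a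
  subsequence converges along points tending to \<open>x\<close>, and closed inequalities survive
  the limit.\<close>

lemma semiconcave_superdiff_nonempty:
  fixes u :: "real^'n \<Rightarrow> real"
  assumes lip: "L-lipschitz_on UNIV u"
    and sc: "\<And>\<epsilon>. 0 < \<epsilon> \<Longrightarrow> \<exists>M\<ge>0. \<forall>a b l. 0 < l \<longrightarrow> l < 1 \<longrightarrow>
      l * u a + (1 - l) * u b - u (l *\<^sub>R a + (1 - l) *\<^sub>R b) \<le> l * (1 - l) * (\<epsilon> * norm (a - b) + M * (norm (a - b))\<^sup>2)"
  shows "superdiff u x \<noteq> {}"
proof -
  have "\<forall>\<epsilon>. \<exists>M. 0 < \<epsilon> \<longrightarrow> (M\<ge>0 \<and> (\<forall>a b l. 0 < l \<longrightarrow> l < 1 \<longrightarrow>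
      l * u a + (1 - l) * u b - u (l *\<^sub>R a + (1 - l) *\<^sub>R b) \<le> l * (1 - l) * (\<epsilon> * norm (a - b) + M * (norm (a - b))\<^sup>2)))"
    using sc by blast
  then obtain M where M: "\<And>\<epsilon>. 0 < \<epsilon> \<Longrightarrow> 0 \<le> M \<epsilon>"
    "\<And>\<epsilon> a b l. 0 < \<epsilon> \<Longrightarrow> 0 < l \<Longrightarrow> l < 1 \<Longrightarrow>
      l * u a + (1 - l) * u b - u (l *\<^sub>R a + (1 - l) *\<^sub>R b) \<le> l * (1 - l) * (\<epsilon> * norm (a - b) + M \<epsilon> * (norm (a - b))\<^sup>2)"
    by metis
  have global: "u z \<le> u y + p \<bullet> (z - y) + \<epsilon> * norm (z - y) + M \<epsilon> * (norm (z - y))\<^sup>2"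
    if p: "p \<in> superdiff u y" and "0 < \<epsilon>" for p y z \<epsilon>
  proof (rule field_le_epsilon)
    fix \<eta> :: real assume "0 < \<eta>"
    define N where "N = norm (z - y)"
    define \<eta>' where "\<eta>' = \<eta> / (N + 1)"
    have N: "N \<ge> 0" by (simp add: N_def)
    have \<eta>': "\<eta>' > 0" "\<eta>' * N \<le> \<eta>" using \<open>0 < \<eta>\<close> N by (simp_all add: \<eta>'_def field_simps)
    obtain d where d: "0 < d" "\<And>z. dist z y < d \<Longrightarrow> u z \<le> u y + p \<bullet> (z - y) + \<eta>' * norm (z - y)"
      using superdiff_le_linear[OF p \<eta>'(1)] by blast
    \<comment> \<open>Small enough for the intermediate point to lie where the linear bound at
      \<open>y\<close> holds; dividing the semiconcavity inequality by \<open>l\<close> then gives a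
      bound at \<open>z\<close>.\<close>
    define l where "l = min (1/2) (d / (2 * (N + 1)))"
    have l: "0 < l" "l < 1" using d N by (auto simp: l_def)
    have "l * N \<le> d / (2 * (N + 1)) * N" using N by (intro mult_right_mono) (auto simp: l_def)
    also have "\<dots> < d" using d N by (simp add: field_simps) (smt (verit) mult_nonneg_nonneg)
    finally have lN: "l * N < d" .
    have eq: "l *\<^sub>R z + (1 - l) *\<^sub>R y = y + l *\<^sub>R (z - y)" by (simp add: algebra_simps)
    have "u (y + l *\<^sub>R (z - y)) \<le> u y + l * (p \<bullet> (z - y)) + \<eta>' * (l * N)"
      using d(2)[of "y + l *\<^sub>R (z - y)"] lN l by (simp add: dist_norm N_def)
    moreover have "l * u z + (1 - l) * u y - u (y + l *\<^sub>R (z - y)) \<le> l * (1 - l) * (\<epsilon> * N + M \<epsilon> * N\<^sup>2)"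
      using M(2)[OF \<open>0 < \<epsilon>\<close> l, of z y] unfolding eq N_def .
    moreover have "l * (1 - l) * (\<epsilon> * N + M \<epsilon> * N\<^sup>2) \<le> l * (\<epsilon> * N + M \<epsilon> * N\<^sup>2)"
      using l M(1)[OF \<open>0 < \<epsilon>\<close>] \<open>0 < \<epsilon>\<close> N by (intro mult_right_mono) auto
    ultimately have "l * u z \<le> l * (u y + p \<bullet> (z - y) + \<eta>' * N + \<epsilon> * N + M \<epsilon> * N\<^sup>2)"
      by (simp add: algebra_simps)
    then show "u z \<le> u y + p \<bullet> (z - y) + \<epsilon> * norm (z - y) + M \<epsilon> * (norm (z - y))\<^sup>2 + \<eta>"
      using l \<eta>'(2) unfolding N_def[symmetric] by simp
  qed
  have cont: "continuous_on UNIV u" by (rule lipschitz_on_continuous_on[OF lip])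
  have "\<exists>y p. dist y x < inverse (real (Suc n)) \<and> p \<in> superdiff u y" for n
    using superdiff_dense[OF cont, of "inverse (real (Suc n))" x] by fastforce
  then obtain y p where yp: "\<And>n. dist (y n) x < inverse (real (Suc n))" "\<And>n. p n \<in> superdiff u (y n)"
    by metis
  have y: "y \<longlonglongrightarrow> x"
    by (rule metric_tendsto_imp_tendsto[OF LIMSEQ_inverse_real_of_nat])
      (use yp(1) in \<open>auto intro!: always_eventually less_imp_le simp: dist_real_def\<close>)
  have "bounded (range p)"
    using superdiff_norm_le[OF yp(2) lip] by (auto simp: bounded_iff)
  then obtain q r where r: "strict_mono r" "(p \<circ> r) \<longlonglongrightarrow> q"
    using bounded_imp_convergent_subsequence by blast
  have yr: "(\<lambda>n. y (r n)) \<longlonglongrightarrow> x" using LIMSEQ_subseq_LIMSEQ[OF y r(1)] by (simp add: o_def)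
  have pr: "(\<lambda>n. p (r n)) \<longlonglongrightarrow> q" using r(2) by (simp add: o_def)
  have ur: "(\<lambda>n. u (y (r n))) \<longlonglongrightarrow> u x"
    using cont yr by (auto simp: continuous_on_eq_continuous_at intro: isCont_tendsto_compose)
  have "q \<in> superdiff u x"
  proof (rule superdiff_modulusI[of M])
    fix z \<epsilon> assume "0 < (\<epsilon>::real)"
    have "(\<lambda>n. u (y (r n)) + p (r n) \<bullet> (z - y (r n)) + \<epsilon> * norm (z - y (r n)) + M \<epsilon> * (norm (z - y (r n)))\<^sup>2)
        \<longlonglongrightarrow> u x + q \<bullet> (z - x) + \<epsilon> * norm (z - x) + M \<epsilon> * (norm (z - x))\<^sup>2"
      by (intro tendsto_intros ur pr yr)
    then show "u z \<le> u x + q \<bullet> (z - x) + \<epsilon> * norm (z - x) + M \<epsilon> * (norm (z - x))\<^sup>2"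
      by (rule LIMSEQ_le_const) (use global[OF yp(2) \<open>0 < \<epsilon>\<close>] in blast)
  qed (use M in auto)
  then show ?thesis by blast
qed

section \<open>Uniform estimates from compactness and from irreducibility\<close>

text \<open>Coercivity is assumed for each \<open>x\<close> separately, and convexity makes it
  uniform: if bounded values occurred at arbitrarily large momenta, \<open>G\<close> would be
  bounded on the segments from 0 to them. In the limit these fill a ray over a single point,
  contradicting coercivity there.\<close>

lemma coercive_uniform:
  fixes G :: "real^'n \<Rightarrow> real^'n \<Rightarrow> real"
  assumes cont: "continuous_on UNIV (\<lambda>(x, p). G x p)" and per: "\<And>p. Zperiodic (\<lambda>x. G x p)"
    and conv: "\<And>x. convex_on UNIV (G x)" and coer: "\<And>x. filterlim (G x) at_top at_infinity"
  obtains K where "\<And>x p. G x p \<le> C \<Longrightarrow> norm p \<le> K"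
proof -
  have contG: "(\<lambda>n. G (x n) (p n)) \<longlonglongrightarrow> G a b" if "x \<longlonglongrightarrow> a" "p \<longlonglongrightarrow> b" for x p a b
    using continuous_on_tendsto_compose[OF cont tendsto_Pair[OF that]] by simp
  have "\<exists>K. \<forall>x\<in>cbox 0 1. \<forall>p. G x p \<le> C \<longrightarrow> norm p \<le> K"
  proof (rule ccontr)
    assume "\<not> ?thesis"
    then have "\<exists>x p. x \<in> cbox 0 1 \<and> G x p \<le> C \<and> real n < norm p" for n
      by (metis not_le)
    then obtain x p where xp: "\<And>n. x n \<in> cbox 0 1" "\<And>n. G (x n) (p n) \<le> C" "\<And>n. real n < norm (p n)"
      by metis
    define e where "e n = (x n, sgn (p n))" for n
    have "e n \<in> cbox 0 1 \<times> cball 0 1" for n using xp(1) by (simp add: e_def norm_sgn)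
    then obtain a r where r: "strict_mono r" "(e \<circ> r) \<longlonglongrightarrow> a"
      using compact_imp_seq_compact[OF compact_Times[OF compact_cbox compact_cball]]
      unfolding seq_compact_def by metis
    have xr: "(\<lambda>n. x (r n)) \<longlonglongrightarrow> fst a" and sr: "(\<lambda>n. sgn (p (r n))) \<longlonglongrightarrow> snd a"
      using tendsto_fst[OF r(2)] tendsto_snd[OF r(2)] by (simp_all add: e_def o_def)
    \<comment> \<open>For a fixed radius \<rho>, the point on the ray is a limit of points of the
      segments from 0 to \<open>p (r n)\<close>, where convexity bounds \<open>G\<close> by its
      values at the two ends.\<close>
    have bound: "G (fst a) (\<rho> *\<^sub>R snd a) \<le> max (G (fst a) 0) C" if "0 < \<rho>" for \<rho>
    proof -
      have lim: "(\<lambda>n. G (x (r n)) (\<rho> *\<^sub>R sgn (p (r n)))) \<longlonglongrightarrow> G (fst a) (\<rho> *\<^sub>R snd a)"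
        by (intro contG xr tendsto_intros sr)
      have lim': "(\<lambda>n. max (G (x (r n)) 0) C) \<longlonglongrightarrow> max (G (fst a) 0) C"
        by (intro tendsto_intros contG xr)
      have "\<forall>\<^sub>F n in sequentially. G (x (r n)) (\<rho> *\<^sub>R sgn (p (r n))) \<le> max (G (x (r n)) 0) C"
        using eventually_ge_at_top[of "nat \<lceil>\<rho>\<rceil>"]
      proof eventually_elim
        fix n assume n: "n \<ge> nat \<lceil>\<rho>\<rceil>"
        have "\<rho> \<le> real (r n)" using seq_suble[OF r(1), of n] n by linarith
        then have less: "\<rho> < norm (p (r n))" using xp(3)[of "r n"] by linarith
        define t where "t = \<rho> / norm (p (r n))"
        have t: "0 \<le> t" "t \<le> 1" using less that by (auto simp: t_def divide_le_eq)
        have "\<rho> *\<^sub>R sgn (p (r n)) = (1 - t) *\<^sub>R 0 + t *\<^sub>R p (r n)"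
          by (simp add: t_def sgn_div_norm divide_inverse)
        then have "G (x (r n)) (\<rho> *\<^sub>R sgn (p (r n))) \<le> (1 - t) * G (x (r n)) 0 + t * G (x (r n)) (p (r n))"
          using convex_onD[OF conv, of t 0 "p (r n)" "x (r n)"] t by simp
        also have "\<dots> \<le> (1 - t) * max (G (x (r n)) 0) C + t * max (G (x (r n)) 0) C"
          using t xp(2)[of "r n"] by (intro add_mono mult_left_mono) auto
        finally show "G (x (r n)) (\<rho> *\<^sub>R sgn (p (r n))) \<le> max (G (x (r n)) 0) C"
          by (simp add: algebra_simps)
      qed
      then show ?thesis by (rule tendsto_le[OF trivial_limit_sequentially lim' lim])
    qed
    have "norm (sgn (p n)) = 1" for n using xp(3)[of n] by (auto simp: norm_sgn)
    then have na: "norm (snd a) = 1"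
      using tendsto_norm[OF sr] by (simp add: LIMSEQ_const_iff)
    have "\<forall>\<^sub>F p in at_infinity. max (G (fst a) 0) C < G (fst a) p"
      using coer[of "fst a"] unfolding filterlim_at_top_dense by blast
    then obtain b where b: "\<And>p. b \<le> norm p \<Longrightarrow> max (G (fst a) 0) C < G (fst a) p"
      unfolding eventually_at_infinity by blast
    have "b \<le> norm ((\<bar>b\<bar> + 1) *\<^sub>R snd a)" using na by simp
    from b[OF this] bound[of "\<bar>b\<bar> + 1"] show False by linarith
  qed
  then obtain K where K: "\<And>x p. x \<in> cbox 0 1 \<Longrightarrow> G x p \<le> C \<Longrightarrow> norm p \<le> K" by blast
  have "norm p \<le> K" if "G x p \<le> C" for x p
  proof -
    obtain k where "int_vec k" "x + k \<in> cbox 0 1" using Zperiodic_translate_unit_cube by blast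
    then show ?thesis using K[of "x + k" p] per[of p] that by (simp add: Zperiodic_def)
  qed
  then show thesis by (rule that)
qed

lemma coercive_bounded_below:
  fixes G :: "real^'n \<Rightarrow> real^'n \<Rightarrow> real"
  assumes cont: "continuous_on UNIV (\<lambda>(x, p). G x p)" and per: "\<And>p. Zperiodic (\<lambda>x. G x p)"
    and conv: "\<And>x. convex_on UNIV (G x)" and coer: "\<And>x. filterlim (G x) at_top at_infinity"
  obtains c where "\<And>x p. c \<le> G x p"
proof -
  obtain K where K: "\<And>x p. G x p \<le> 0 \<Longrightarrow> norm p \<le> K" using coercive_uniform[OF assms] by blast
  have "bounded ((\<lambda>(x, p). G x p) ` (cbox 0 1 \<times> cball 0 K))"
    by (intro compact_imp_bounded compact_continuous_image continuous_on_subset[OF cont] compact_Times) auto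
  then obtain B where B: "\<And>x p. x \<in> cbox 0 1 \<Longrightarrow> norm p \<le> K \<Longrightarrow> \<bar>G x p\<bar> \<le> B"
    unfolding bounded_iff by fastforce
  have "- \<bar>B\<bar> \<le> G x p" for x p
  proof -
    obtain k where k: "int_vec k" "x + k \<in> cbox 0 1" using Zperiodic_translate_unit_cube by blast
    then show ?thesis using B[OF k(2), of p] K[of x p] per[of p] by (simp add: Zperiodic_def) linarith
  qed
  then show thesis by (rule that)
qed

text \<open>The midpoint gap is continuous and positive on the compact set of triples whose momenta
  are at least \<epsilon> apart, so it has a positive minimum.\<close>

lemma strictly_convex_uniform:
  fixes G :: "real^'n \<Rightarrow> real^'n \<Rightarrow> real"
  assumes cont: "continuous_on UNIV (\<lambda>(x, p). G x p)" and strict: "\<And>x. strictly_convex_on UNIV (G x)"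
    and "0 < \<epsilon>"
  shows "\<exists>\<delta>>0. \<forall>x\<in>cball 0 R. \<forall>p\<in>cball 0 R. \<forall>q\<in>cball 0 R.
      \<epsilon> \<le> norm (p - q) \<longrightarrow> G x ((1/2) *\<^sub>R (p + q)) \<le> (G x p + G x q) / 2 - \<delta>"
proof -
  define S where "S = (cball 0 R \<times> cball 0 R \<times> cball 0 R) \<inter> {z :: (real^'n) \<times> (real^'n) \<times> (real^'n). \<epsilon> \<le> norm (fst (snd z) - snd (snd z))}"
  define f where "f z = (G (fst z) (fst (snd z)) + G (fst z) (snd (snd z))) / 2
    - G (fst z) ((1/2) *\<^sub>R (fst (snd z) + snd (snd z)))" for z :: "(real^'n) \<times> (real^'n) \<times> (real^'n)"
  have "compact S" unfolding S_def
    by (intro compact_Int_closed compact_Times compact_cball closed_Collect_le continuous_intros)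
  have comp: "continuous_on S (\<lambda>z. G (g z) (h z))" if "continuous_on S g" "continuous_on S h" for g h
    using continuous_on_compose2[OF cont continuous_on_Pair[OF that]] by simp
  have "continuous_on S f" unfolding f_def by (intro continuous_intros comp) simp
  have pos: "0 < f z" if "z \<in> S" for z
  proof -
    have "fst (snd z) \<noteq> snd (snd z)" using that \<open>0 < \<epsilon>\<close> by (auto simp: S_def)
    then have "G (fst z) ((1 - 1/2) *\<^sub>R fst (snd z) + (1/2) *\<^sub>R snd (snd z))
        < (1 - 1/2) * G (fst z) (fst (snd z)) + (1/2) * G (fst z) (snd (snd z))"
      by (intro strict[of "fst z", unfolded strictly_convex_on_def, rule_format]) auto
    then show ?thesis by (simp add: f_def scaleR_right_distrib)
  qed
  obtain \<delta> where \<delta>: "0 < \<delta>" "\<And>z. z \<in> S \<Longrightarrow> \<delta> \<le> f z"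
  proof (cases "S = {}")
    case True
    then show ?thesis using that[of 1] by simp
  next
    case False
    then obtain z where "z \<in> S" "\<And>y. y \<in> S \<Longrightarrow> f z \<le> f y"
      using continuous_attains_inf[OF \<open>compact S\<close> _ \<open>continuous_on S f\<close>] by blast
    then show ?thesis using pos that[of "f z"] by blast
  qed
  show ?thesis
  proof (intro exI[of _ \<delta>] conjI ballI impI)
    fix x p q :: "real^'n" assume "x \<in> cball 0 R" "p \<in> cball 0 R" "q \<in> cball 0 R" "\<epsilon> \<le> norm (p - q)"
    then have "(x, p, q) \<in> S" by (simp add: S_def)
    from \<delta>(2)[OF this] show "G x ((1/2) *\<^sub>R (p + q)) \<le> (G x p + G x q) / 2 - \<delta>"
      by (simp add: f_def)
  qed (use \<delta> in simp)
qed

lemma locally_lipschitz_imp_lipschitz_on_compact: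
  fixes f :: "'a::metric_space \<Rightarrow> 'b::metric_space"
  assumes loc: "\<And>z. \<exists>e>0. \<exists>L. L-lipschitz_on (ball z e) f" and "compact S"
  obtains L where "L-lipschitz_on S f"
proof -
  \<comment> \<open>A one-point time set turns the time-dependent notion of the library into the
    plain one.\<close>
  have "local_lipschitz {0::real} S (\<lambda>_. f)"
  proof (rule local_lipschitzI)
    fix t :: real and z assume "t \<in> {0}" "z \<in> S"
    obtain e L where eL: "e > 0" "L-lipschitz_on (ball z e) f" using loc by blast
    then have "L-lipschitz_on (cball z (e/2) \<inter> S) f"
      by (intro lipschitz_on_subset[OF eL(2)]) auto
    then show "\<exists>u>0. \<exists>L. \<forall>t\<in>cball t u \<inter> {0}. L-lipschitz_on (cball z u \<inter> S) f"
      using eL(1) by (intro exI[of _ "e/2"]) auto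
  qed
  then show thesis
    using local_lipschitz_compact_implies_lipschitz[of "{0::real}" S "\<lambda>_. f"] assms(2) that by auto
qed

text \<open>If \<open>v\<close> is maximal at \<open>i\<^sub>0\<close>, then a bound on \<open>v\<^sub>i\<^sub>0 - v\<^sub>i\<close> propagates along every edge
  \<open>A\<^sub>i\<^sub>j < 0\<close>; by irreducibility it reaches all indices.\<close>
lemma irreducible_oscillation_bound:
  fixes A :: "real^'m^'m"
  assumes offdiag: "\<And>i j. i \<noteq> j \<Longrightarrow> A $ i $ j \<le> 0" and rows: "\<And>i. (\<Sum>j\<in>UNIV. A $ i $ j) = 0"
    and irred: "\<And>W. W \<noteq> {} \<Longrightarrow> W \<noteq> UNIV \<Longrightarrow> \<exists>i\<in>W. \<exists>j. j \<notin> W \<and> A $ i $ j < 0"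
  shows "\<exists>D. \<forall>v. (\<forall>i. (\<Sum>j\<in>UNIV. A $ i $ j * v $ j) \<le> C) \<longrightarrow> (\<forall>i j. v $ i - v $ j \<le> D)"
proof -
  have "\<exists>D. \<forall>v. (\<forall>i. (\<Sum>j\<in>UNIV. A $ i $ j * v $ j) \<le> C) \<and> (\<forall>k. v $ k \<le> v $ m) \<longrightarrow> v $ m - v $ j \<le> D" for m j
  proof -
    \<comment> \<open>Indices reached by a bound uniform in \<open>v\<close>. The maximal index
      \<open>m\<close> is held fixed; the dependence on it is removed at the end by a finite
      maximum.\<close>
    define W where "W = {j. \<exists>D. \<forall>v. (\<forall>i. (\<Sum>j\<in>UNIV. A $ i $ j * v $ j) \<le> C) \<and> (\<forall>k. v $ k \<le> v $ m) \<longrightarrow> v $ m - v $ j \<le> D}"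
    have "m \<in> W" by (auto simp: W_def)
    have "W = UNIV"
    proof (rule ccontr)
      assume "W \<noteq> UNIV"
      with irred[of W] \<open>m \<in> W\<close> obtain i j where ij: "i \<in> W" "j \<notin> W" "A $ i $ j < 0" by blast
      from ij(1) obtain D where D: "\<And>v. (\<forall>i. (\<Sum>j\<in>UNIV. A $ i $ j * v $ j) \<le> C) \<Longrightarrow>
          (\<forall>k. v $ k \<le> v $ m) \<Longrightarrow> v $ m - v $ i \<le> D"
        unfolding W_def by blast
      have "v $ m - v $ j \<le> (C + \<bar>A $ i $ i\<bar> * \<bar>D\<bar>) / (- A $ i $ j)"
        if v: "\<forall>i. (\<Sum>j\<in>UNIV. A $ i $ j * v $ j) \<le> C" "\<forall>k. v $ k \<le> v $ m" for v
      proof -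
        have "i \<noteq> j" using ij by blast
        have "(\<Sum>k\<in>UNIV. A $ i $ k * (v $ k - v $ m)) \<le> C"
          using v(1) rows[of i] by (simp add: right_diff_distrib sum_subtractf flip: sum_distrib_right)
        moreover have "(\<Sum>k\<in>{i, j}. A $ i $ k * (v $ k - v $ m)) \<le> (\<Sum>k\<in>UNIV. A $ i $ k * (v $ k - v $ m))"
          using offdiag v(2) by (intro sum_mono2) (auto intro!: mult_nonpos_nonpos)
        ultimately have "A $ i $ j * (v $ j - v $ m) \<le> C + A $ i $ i * (v $ m - v $ i)"
          using \<open>i \<noteq> j\<close> by (simp add: algebra_simps)
        moreover have "A $ i $ i * (v $ m - v $ i) \<le> \<bar>A $ i $ i\<bar> * \<bar>D\<bar>"
        proof -
          have "A $ i $ i * (v $ m - v $ i) \<le> \<bar>A $ i $ i\<bar> * (v $ m - v $ i)"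
            using v(2) by (intro mult_right_mono) auto
          also have "\<dots> \<le> \<bar>A $ i $ i\<bar> * \<bar>D\<bar>" using D[OF v] by (intro mult_left_mono) auto
          finally show ?thesis .
        qed
        ultimately have "(v $ m - v $ j) * (- A $ i $ j) \<le> C + \<bar>A $ i $ i\<bar> * \<bar>D\<bar>"
          by (simp add: algebra_simps)
        then show ?thesis using ij(3) by (subst pos_le_divide_eq) auto
      qed
      then have "j \<in> W" unfolding W_def by blast
      with ij(2) show False by blast
    qed
    then have "j \<in> W" by blast
    then show ?thesis unfolding W_def by blast
  qed
  then obtain D where D: "\<And>m j v. (\<forall>i. (\<Sum>j\<in>UNIV. A $ i $ j * v $ j) \<le> C) \<Longrightarrow> (\<forall>k. v $ k \<le> v $ m) \<Longrightarrow> v $ m - v $ j \<le> D m j"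
    by metis
  define D' where "D' = Max (range (\<lambda>(m, j). D m j))"
  have "v $ i - v $ j \<le> D'" if v: "\<And>i. (\<Sum>j\<in>UNIV. A $ i $ j * v $ j) \<le> C" for v i j
  proof -
    have "Max (range (($) v)) \<in> range (($) v)" by (intro Max_in) auto
    then obtain m where "v $ m = Max (range (($) v))" by (metis rangeE)
    then have m: "v $ k \<le> v $ m" for k by simp
    have "v $ i - v $ j \<le> v $ m - v $ j" using m by simp
    also have "\<dots> \<le> D m j" using D v m by blast
    also have "\<dots> \<le> D'" unfolding D'_def by (intro Max_ge) auto
    finally show ?thesis .
  qed
  then show ?thesis by blast
qed

section \<open>The system: a priori bounds, maximal subsolutions, superdifferentials\<close>

text \<open>The constant depends only on \<open>H\<close>, \<open>A\<close> and \<alpha>: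
  oscillation between components controls the coupling term, which then bounds the Hamiltonian and
  so the momenta.\<close>

lemma sys_subsol_equi_lipschitz:
  fixes H :: "'m::finite \<Rightarrow> real^'n \<Rightarrow> real^'n \<Rightarrow> real" and A :: "real^'m^'m"
  assumes H_cont: "\<And>i. continuous_on UNIV (\<lambda>(x, p). H i x p)"
    and H_per: "\<And>i p. Zperiodic (\<lambda>x. H i x p)"
    and H_conv: "\<And>i x. convex_on UNIV (H i x)"
    and H_coer: "\<And>i x. filterlim (H i x) at_top at_infinity"
    and A_offdiag: "\<And>i j. i \<noteq> j \<Longrightarrow> A $ i $ j \<le> 0"
    and A_rows: "\<And>i. (\<Sum>j\<in>UNIV. A $ i $ j) = 0"
    and A_irred: "\<And>W. W \<noteq> {} \<Longrightarrow> W \<noteq> UNIV \<Longrightarrow> \<exists>i\<in>W. \<exists>j. j \<notin> W \<and> A $ i $ j < 0"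
  shows "\<exists>L. \<forall>u i. sys_subsol H A \<alpha> u \<longrightarrow> L-lipschitz_on UNIV (\<lambda>x. u x $ i)"
proof -
  have "\<forall>i. \<exists>c. \<forall>x p. c \<le> H i x p"
    using coercive_bounded_below[OF H_cont H_per H_conv H_coer] by metis
  then obtain c' where c': "\<And>i x p. c' i \<le> H i x p" by metis
  define c where "c = Min (range c')"
  have c: "c \<le> H i x p" for i x p
    unfolding c_def by (rule order_trans[OF Min_le c']) auto
  have "\<exists>D. \<forall>v. (\<forall>i. (\<Sum>j\<in>UNIV. A $ i $ j * v $ j) \<le> \<alpha> - c) \<longrightarrow> (\<forall>i j. v $ i - v $ j \<le> D)"
    using A_offdiag A_rows A_irred by (rule irreducible_oscillation_bound)
  then obtain D where D: "\<And>v i j. \<forall>i. (\<Sum>j\<in>UNIV. A $ i $ j * v $ j) \<le> \<alpha> - c \<Longrightarrow> v $ i - v $ j \<le> D"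
    by blast
  \<comment> \<open>Bounds the negative of the coupling term, which equals a combination of
    differences of components because the rows sum to zero.\<close>
  define E where "E = Max (range (\<lambda>i. \<Sum>j\<in>UNIV. \<bar>A $ i $ j\<bar> * D))"
  have "\<forall>i. \<exists>K. \<forall>x p. H i x p \<le> \<alpha> + E \<longrightarrow> norm p \<le> K"
    using coercive_uniform[OF H_cont H_per H_conv H_coer] by metis
  then obtain K' where K': "\<And>i x p. H i x p \<le> \<alpha> + E \<Longrightarrow> norm p \<le> K' i" by metis
  define K where "K = max 0 (Max (range K'))"
  have K: "norm p \<le> K" if "H i x p \<le> \<alpha> + E" for i x p
  proof -
    have "K' i \<le> Max (range K')" by (intro Max_ge) auto
    then show ?thesis unfolding K_def by (rule order_trans[OF K'[OF that] max.coboundedI2])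
  qed
  have "0 \<le> K" by (simp add: K_def)
  have "K-lipschitz_on UNIV (\<lambda>x. u x $ i)" if u: "sys_subsol H A \<alpha> u" for u i
  proof -
    have cont: "continuous_on UNIV (\<lambda>x. u x $ i)" for i using u by (simp add: sys_subsol_def)
    have sub: "H i x p + (\<Sum>j\<in>UNIV. A $ i $ j * u x $ j) \<le> \<alpha>" if "p \<in> superdiff (\<lambda>y. u y $ i) x" for i x p
      using u that by (simp add: sys_subsol_def)
    \<comment> \<open>Where the bound fails, the subsolution inequality would put \<open>H\<close>
      below its minorant \<open>c\<close>, so no superdifferential exists there; but this set is
      open and superdifferentials are dense.\<close>
    have Au: "(\<Sum>j\<in>UNIV. A $ i $ j * u x $ j) \<le> \<alpha> - c" for i x
    proof (rule ccontr)
      assume neg: "\<not> ?thesis"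
      define U where "U = {x. \<alpha> - c < (\<Sum>j\<in>UNIV. A $ i $ j * u x $ j)}"
      have "open U" unfolding U_def by (intro open_Collect_less continuous_intros cont)
      moreover have "x \<in> U" using neg by (simp add: U_def)
      ultimately obtain e where e: "e > 0" "ball x e \<subseteq> U" by (rule openE)
      obtain y p where yp: "dist y x < e" "p \<in> superdiff (\<lambda>y. u y $ i) y"
        using superdiff_dense[OF cont e(1)] by blast
      then have "y \<in> U" using e(2) by (auto simp: dist_commute)
      then show False using sub[OF yp(2)] c[of i y p] by (simp add: U_def)
    qed
    have osc: "u x $ i - u x $ j \<le> D" for x i j using D Au by blast
    have "H i x p \<le> \<alpha> + E" if p: "p \<in> superdiff (\<lambda>y. u y $ i) x" for x p
    proof -
      have "- (\<Sum>j\<in>UNIV. A $ i $ j * u x $ j) = (\<Sum>j\<in>UNIV. A $ i $ j * (u x $ i - u x $ j))"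
        using A_rows[of i] by (simp add: right_diff_distrib sum_subtractf flip: sum_distrib_right)
      also have "\<dots> \<le> (\<Sum>j\<in>UNIV. \<bar>A $ i $ j\<bar> * D)"
      proof (rule sum_mono)
        fix j
        have "\<bar>u x $ i - u x $ j\<bar> \<le> D" using osc[of x i j] osc[of x j i] by (simp add: abs_le_iff)
        then have "\<bar>A $ i $ j\<bar> * \<bar>u x $ i - u x $ j\<bar> \<le> \<bar>A $ i $ j\<bar> * D"
          by (rule mult_left_mono) simp
        then show "A $ i $ j * (u x $ i - u x $ j) \<le> \<bar>A $ i $ j\<bar> * D"
          using abs_ge_self[of "A $ i $ j * (u x $ i - u x $ j)"] by (simp add: abs_mult)
      qed
      also have "\<dots> \<le> E" unfolding E_def by (intro Max_ge) auto
      finally show ?thesis using sub[OF p] by simp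
    qed
    moreover have "Zperiodic (\<lambda>x. u x $ i)" using u by (simp add: sys_subsol_def Zperiodic_def)
    then obtain B where "\<And>x. \<bar>u x $ i\<bar> \<le> B" using Zperiodic_bounded[OF cont] by blast
    ultimately show ?thesis
      using K \<open>0 \<le> K\<close> superdiff_bounded_imp_lipschitz[OF cont] by blast
  qed
  then show ?thesis by blast
qed

text \<open>The off-diagonal signs of \<open>A\<close> make the coupling monotone in the other components.\<close>
lemma sys_subsol_Sup:
  fixes H :: "'m::finite \<Rightarrow> real^'n \<Rightarrow> real^'n \<Rightarrow> real" and A :: "real^'m^'m"
  assumes H_cont: "\<And>i. continuous_on UNIV (\<lambda>(x, p). H i x p)"
    and A_offdiag: "\<And>i j. i \<noteq> j \<Longrightarrow> A $ i $ j \<le> 0"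
    and lip: "\<And>v i. v \<in> S \<Longrightarrow> L-lipschitz_on UNIV (\<lambda>x. v x $ i)"
    and sub: "\<And>v. v \<in> S \<Longrightarrow> sys_subsol H A \<alpha> v" and "S \<noteq> {}"
    and bdd: "\<And>x i. bdd_above ((\<lambda>v. v x $ i) ` S)"
  defines "w \<equiv> \<lambda>x. \<chi> i. SUP v\<in>S. v x $ i"
  shows "sys_subsol H A \<alpha> w"
proof -
  have w: "w x $ i = (SUP v\<in>S. v x $ i)" for x i by (simp add: w_def)
  have le_w: "v x $ i \<le> w x $ i" if "v \<in> S" for v x i
    unfolding w by (rule cSUP_upper[OF that bdd])
  have ulip: "\<bar>v x $ i - v y $ i\<bar> \<le> L * norm (x - y)" if "v \<in> S" for v x y i
    using lipschitz_real_abs_le[OF lip[OF that, of i]] .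
  have w_le: "w x $ i \<le> w y $ i + L * norm (x - y)" for x y i
    unfolding w[of x]
  proof (rule cSUP_least[OF \<open>S \<noteq> {}\<close>])
    fix v assume "v \<in> S"
    then show "v x $ i \<le> w y $ i + L * norm (x - y)"
      using ulip[of v x i y] le_w[of v y i] by (simp add: abs_le_iff)
  qed
  have "L \<ge> 0" using \<open>S \<noteq> {}\<close> lip lipschitz_on_nonneg by blast
  have w_abs: "\<bar>w x $ i - w y $ i\<bar> \<le> L * norm (x - y)" for x y i
    using w_le[of x i y] w_le[of y i x] by (simp add: abs_le_iff norm_minus_commute)
  have wlip: "L-lipschitz_on UNIV (\<lambda>x. w x $ i)" for i
    using \<open>L \<ge> 0\<close> w_abs by (intro lipschitz_onI) (auto simp: dist_norm)
  have wcont: "continuous_on UNIV (\<lambda>x. w x $ i)" for i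
    by (rule lipschitz_on_continuous_on[OF wlip])
  have "Zperiodic w"
    using sub unfolding Zperiodic_def sys_subsol_def w_def by (auto intro!: arg_cong[where f = Sup] simp: vec_eq_iff)
  have "H i x p + (\<Sum>j\<in>UNIV. A $ i $ j * w x $ j) \<le> \<alpha>" if p: "p \<in> superdiff (\<lambda>y. w y $ i) x" for i x p
  proof -
    obtain \<phi> \<phi>' e where \<phi>: "\<And>y. (\<phi> has_derivative (\<lambda>h. \<phi>' y \<bullet> h)) (at y)" "continuous_on UNIV \<phi>'"
      "\<phi>' x = p" "\<phi> x = w x $ i" "e > 0" "\<And>y. dist y x < e \<Longrightarrow> w y $ i \<le> \<phi> y"
      using p unfolding superdiff_def by blast
    have \<phi>_cont: "continuous_on UNIV \<phi>"
      using \<phi>(1) by (meson continuous_at_imp_continuous_on has_derivative_continuous)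
    \<comment> \<open>The supremum need not be attained, so \<open>v\<close> is chosen within
      \<delta>^2 of it at \<open>x\<close>. The added |z - x|^2 puts \<open>v - \<psi>\<close> at or
      below -\<delta>^2 on the sphere, while it is above that at the centre, so the maximum is
      interior.\<close>
    have approx: "\<exists>y s. dist y x < \<delta> \<and> \<bar>s - w x $ i\<bar> \<le> \<delta>\<^sup>2 + L * \<delta> \<and>
        H i y (\<phi>' y + 2 *\<^sub>R (y - x)) + (A $ i $ i * s + (\<Sum>j\<in>UNIV - {i}. A $ i $ j * w y $ j)) \<le> \<alpha>"
      if "0 < \<delta>" "\<delta> < e" for \<delta>
    proof -
      have "w x $ i - \<delta>\<^sup>2 < (SUP v\<in>S. v x $ i)" using \<open>0 < \<delta>\<close> w by simp
      then obtain v where v: "v \<in> S" "w x $ i - \<delta>\<^sup>2 < v x $ i"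
        using less_cSUP_iff[OF \<open>S \<noteq> {}\<close> bdd] by blast
      define \<psi> where "\<psi> z = \<phi> z + (0 \<bullet> (z - x) + 1 * (norm (z - x))\<^sup>2)" for z
      have \<psi>_deriv: "(\<psi> has_derivative (\<lambda>h. (\<phi>' z + 2 *\<^sub>R (z - x)) \<bullet> h)) (at z)" for z
        unfolding \<psi>_def
        using has_derivative_add[OF \<phi>(1) has_derivative_quadratic[where p = 0 and k = 1 and x = x and z = z]]
        by (simp add: inner_add_left)
      have vcont: "continuous_on UNIV (\<lambda>x. v x $ i)"
        using lipschitz_on_continuous_on[OF lip[OF v(1)]] .
      have "\<exists>y\<in>cball x \<delta>. \<forall>z\<in>cball x \<delta>. v z $ i - \<psi> z \<le> v y $ i - \<psi> y"
        using \<open>0 < \<delta>\<close> unfolding \<psi>_def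
        by (intro continuous_attains_sup continuous_intros continuous_on_subset[OF vcont]
            continuous_on_subset[OF \<phi>_cont]) auto
      then obtain y where y: "y \<in> cball x \<delta>" "\<And>z. z \<in> cball x \<delta> \<Longrightarrow> v z $ i - \<psi> z \<le> v y $ i - \<psi> y"
        by blast
      have less: "dist y x < \<delta>"
      proof (rule ccontr)
        assume "\<not> dist y x < \<delta>"
        then have "norm (y - x) = \<delta>" using y(1) by (simp add: dist_norm norm_minus_commute)
        then show False
          using y(2)[of x] v \<phi>(4) \<phi>(6)[of y] le_w[OF v(1), of y i] that by (simp add: \<psi>_def dist_norm)
      qed
      have "\<phi>' y + 2 *\<^sub>R (y - x) \<in> superdiff (\<lambda>z. v z $ i) y"
      proof (rule superdiff_touchI[OF \<psi>_deriv])
        show "0 < \<delta> - dist y x" using less by simp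
        fix z assume "dist z y < \<delta> - dist y x"
        then have "z \<in> cball x \<delta>"
          using dist_triangle[of z x y] by (simp add: dist_commute)
        then show "v z $ i - \<psi> z \<le> v y $ i - \<psi> y" by (rule y(2))
      qed (intro continuous_intros \<phi>(2))
      then have "H i y (\<phi>' y + 2 *\<^sub>R (y - x)) + (\<Sum>j\<in>UNIV. A $ i $ j * v y $ j) \<le> \<alpha>"
        using sub[OF v(1)] by (simp add: sys_subsol_def)
      moreover have "(\<Sum>j\<in>UNIV. A $ i $ j * v y $ j) = A $ i $ i * v y $ i + (\<Sum>j\<in>UNIV - {i}. A $ i $ j * v y $ j)"
        by (rule sum.remove) auto
      \<comment> \<open>Off the diagonal monotonicity replaces \<open>v\<close> by \<open>w\<close>.
        The diagonal term keeps the value of \<open>v\<close> at \<open>y\<close>, the number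
        \<open>s\<close>, which is shown to converge to \<open>w x $ i\<close>.\<close>
      moreover have "(\<Sum>j\<in>UNIV - {i}. A $ i $ j * w y $ j) \<le> (\<Sum>j\<in>UNIV - {i}. A $ i $ j * v y $ j)"
        using A_offdiag le_w[OF v(1)] by (intro sum_mono mult_left_mono_neg) auto
      ultimately have "H i y (\<phi>' y + 2 *\<^sub>R (y - x)) + (A $ i $ i * v y $ i + (\<Sum>j\<in>UNIV - {i}. A $ i $ j * w y $ j)) \<le> \<alpha>"
        by linarith
      moreover have "\<bar>v y $ i - v x $ i\<bar> \<le> L * \<delta>"
        using ulip[OF v(1), of y i x] less \<open>L \<ge> 0\<close> mult_left_mono[of "norm (y - x)" \<delta> L]
        by (simp add: dist_norm)
      then have "\<bar>v y $ i - w x $ i\<bar> \<le> \<delta>\<^sup>2 + L * \<delta>"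
        using v(2) le_w[OF v(1), of x i] by linarith
      ultimately show ?thesis using less by blast
    qed
    define \<delta> where "\<delta> n = e * inverse (real (Suc (Suc n)))" for n
    have \<delta>: "0 < \<delta> n" "\<delta> n < e" for n
      using \<phi>(5) by (simp_all add: \<delta>_def divide_less_eq add_pos_nonneg flip: divide_inverse)
    have \<delta>_lim: "\<delta> \<longlonglongrightarrow> 0"
      unfolding \<delta>_def using tendsto_mult_right_zero[OF LIMSEQ_Suc[OF LIMSEQ_inverse_real_of_nat]] .
    have "\<forall>n. \<exists>y s. dist y x < \<delta> n \<and> \<bar>s - w x $ i\<bar> \<le> (\<delta> n)\<^sup>2 + L * \<delta> n \<and>
        H i y (\<phi>' y + 2 *\<^sub>R (y - x)) + (A $ i $ i * s + (\<Sum>j\<in>UNIV - {i}. A $ i $ j * w y $ j)) \<le> \<alpha>"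
      using approx[OF \<delta>] by blast
    then obtain y s where ys: "\<And>n. dist (y n) x < \<delta> n" "\<And>n. \<bar>s n - w x $ i\<bar> \<le> (\<delta> n)\<^sup>2 + L * \<delta> n"
      "\<And>n. H i (y n) (\<phi>' (y n) + 2 *\<^sub>R (y n - x)) + (A $ i $ i * s n + (\<Sum>j\<in>UNIV - {i}. A $ i $ j * w (y n) $ j)) \<le> \<alpha>"
      unfolding choice_iff by blast
    have "dist (y n) x \<le> dist (\<delta> n) 0" for n using ys(1)[of n] \<delta>(1)[of n] by simp
    then have y_lim: "y \<longlonglongrightarrow> x"
      by (intro metric_tendsto_imp_tendsto[OF \<delta>_lim]) simp
    have "(\<lambda>n. s n - w x $ i) \<longlonglongrightarrow> 0"
    proof (rule Lim_null_comparison)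
      show "\<forall>\<^sub>F n in sequentially. norm (s n - w x $ i) \<le> (\<delta> n)\<^sup>2 + L * \<delta> n" using ys(2) by simp
      have "(\<lambda>n. (\<delta> n)\<^sup>2 + L * \<delta> n) \<longlonglongrightarrow> 0\<^sup>2 + L * 0" by (intro tendsto_intros \<delta>_lim)
      then show "(\<lambda>n. (\<delta> n)\<^sup>2 + L * \<delta> n) \<longlonglongrightarrow> 0" by simp
    qed
    then have s_lim: "s \<longlonglongrightarrow> w x $ i" by (rule LIM_zero_cancel)
    have "(\<lambda>n. \<phi>' (y n)) \<longlonglongrightarrow> \<phi>' x"
      using continuous_on_tendsto_compose[OF \<phi>(2) y_lim] by simp
    then have "(\<lambda>n. \<phi>' (y n) + 2 *\<^sub>R (y n - x)) \<longlonglongrightarrow> \<phi>' x + 2 *\<^sub>R (x - x)"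
      by (intro tendsto_intros y_lim)
    then have "(\<lambda>n. H i (y n) (\<phi>' (y n) + 2 *\<^sub>R (y n - x))) \<longlonglongrightarrow> H i x p"
      using continuous_on_tendsto_compose[OF H_cont[of i] tendsto_Pair[OF y_lim]] \<phi>(3) by simp
    moreover have w_lim: "(\<lambda>n. w (y n) $ j) \<longlonglongrightarrow> w x $ j" for j
      using continuous_on_tendsto_compose[OF wcont y_lim] by simp
    ultimately have "(\<lambda>n. H i (y n) (\<phi>' (y n) + 2 *\<^sub>R (y n - x)) + (A $ i $ i * s n + (\<Sum>j\<in>UNIV - {i}. A $ i $ j * w (y n) $ j)))
        \<longlonglongrightarrow> H i x p + (A $ i $ i * w x $ i + (\<Sum>j\<in>UNIV - {i}. A $ i $ j * w x $ j))"
      by (intro tendsto_add tendsto_mult tendsto_sum tendsto_const s_lim w_lim)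
    then have "H i x p + (A $ i $ i * w x $ i + (\<Sum>j\<in>UNIV - {i}. A $ i $ j * w x $ j)) \<le> \<alpha>"
      by (rule LIMSEQ_le_const2) (use ys(3) in blast)
    moreover have "(\<Sum>j\<in>UNIV. A $ i $ j * w x $ j) = A $ i $ i * w x $ i + (\<Sum>j\<in>UNIV - {i}. A $ i $ j * w x $ j)"
      by (rule sum.remove) auto
    ultimately show ?thesis by simp
  qed
  with wcont \<open>Zperiodic w\<close> show ?thesis by (simp add: sys_subsol_def)
qed


text \<open>Needed because \<open>aubry_set\<close> quantifies over every maximal subsolution and
  would say nothing if there were none. The candidate is the supremum of all critical subsolutions
  with the prescribed value at \<open>y\<close>, finite because they are equi-Lipschitz.\<close>

lemma max_crit_subsol_exists:
  fixes H :: "'m::finite \<Rightarrow> real^'n \<Rightarrow> real^'n \<Rightarrow> real" and A :: "real^'m^'m"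
  assumes H_cont: "\<And>i. continuous_on UNIV (\<lambda>(x, p). H i x p)"
    and H_per: "\<And>i p. Zperiodic (\<lambda>x. H i x p)"
    and H_conv: "\<And>i x. convex_on UNIV (H i x)"
    and H_coer: "\<And>i x. filterlim (H i x) at_top at_infinity"
    and A_offdiag: "\<And>i j. i \<noteq> j \<Longrightarrow> A $ i $ j \<le> 0"
    and A_rows: "\<And>i. (\<Sum>j\<in>UNIV. A $ i $ j) = 0"
    and A_irred: "\<And>W. W \<noteq> {} \<Longrightarrow> W \<noteq> UNIV \<Longrightarrow> \<exists>i\<in>W. \<exists>j. j \<notin> W \<and> A $ i $ j < 0"
    and u: "sys_subsol H A (crit_value H A) u"
  obtains w where "max_crit_subsol H A y (u y) w"
proof -
  have "\<exists>L. \<forall>u i. sys_subsol H A (crit_value H A) u \<longrightarrow> L-lipschitz_on UNIV (\<lambda>x. u x $ i)"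
    using H_cont H_per H_conv H_coer A_offdiag A_rows A_irred by (rule sys_subsol_equi_lipschitz)
  then obtain L where L: "\<And>u i. sys_subsol H A (crit_value H A) u \<Longrightarrow> L-lipschitz_on UNIV (\<lambda>x. u x $ i)"
    by blast
  define S where "S = {v. sys_subsol H A (crit_value H A) v \<and> v y = u y}"
  have "u \<in> S" using u by (simp add: S_def)
  have "v x $ i \<le> u y $ i + L * norm (x - y)" if "v \<in> S" for v x i
    using lipschitz_real_abs_le[OF L[of v i], of x y] that by (simp add: S_def abs_le_iff)
  then have bdd: "bdd_above ((\<lambda>v. v x $ i) ` S)" for x i
    by (intro bdd_aboveI2) auto
  define w where "w x = (\<chi> i. SUP v\<in>S. v x $ i)" for x
  have "sys_subsol H A (crit_value H A) w"
    unfolding w_def using L \<open>u \<in> S\<close>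
    by (intro sys_subsol_Sup[where L = L] H_cont A_offdiag bdd) (auto simp: S_def)
  moreover have "w y = u y"
  proof -
    have "(SUP v\<in>S. v y $ i) = (SUP v\<in>S. u y $ i)" for i
      by (rule SUP_cong) (auto simp: S_def)
    moreover have "S \<noteq> {}" using \<open>u \<in> S\<close> by blast
    ultimately show ?thesis by (simp add: w_def vec_eq_iff)
  qed
  moreover have "v x $ i \<le> w x $ i" if "v \<in> S" for v x i
    unfolding w_def using cSUP_upper[OF that bdd] by simp
  ultimately have "max_crit_subsol H A y (u y) w" by (simp add: max_crit_subsol_def S_def)
  then show thesis by (rule that)
qed

lemma sys_sol_superdiff_nonempty:
  fixes H :: "'m::finite \<Rightarrow> real^'n \<Rightarrow> real^'n \<Rightarrow> real" and A :: "real^'m^'m"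
  assumes H_cont: "\<And>i. continuous_on UNIV (\<lambda>(x, p). H i x p)"
    and H_conv: "\<And>i x. convex_on UNIV (H i x)"
    and H_strict: "\<And>i x. strictly_convex_on UNIV (H i x)"
    and H_loclip: "\<And>i z. \<exists>e>0. \<exists>L. L-lipschitz_on (ball z e) (\<lambda>(x, p). H i x p)"
    and lip: "\<And>i. L-lipschitz_on UNIV (\<lambda>x. u x $ i)"
    and sol: "sys_sol H A \<alpha> u"
  shows "superdiff (\<lambda>y. u y $ i) x \<noteq> {}"
proof (rule semiconcave_superdiff_nonempty[OF lip])
  fix \<epsilon> :: real assume "0 < \<epsilon>"
  \<comment> \<open>The coupling is frozen along the given solution; only its Lipschitz dependence
    on the point is retained.\<close>
  define f where "f x = (\<Sum>j\<in>UNIV. A $ i $ j * u x $ j) - \<alpha>" for x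
  have f_lip: "\<bar>f x - f y\<bar> \<le> (\<Sum>j\<in>UNIV. \<bar>A $ i $ j\<bar> * L) * norm (x - y)" for x y
  proof -
    have "\<bar>f x - f y\<bar> = \<bar>\<Sum>j\<in>UNIV. A $ i $ j * (u x $ j - u y $ j)\<bar>"
      by (simp add: f_def right_diff_distrib sum_subtractf)
    also have "\<dots> \<le> (\<Sum>j\<in>UNIV. \<bar>A $ i $ j\<bar> * (L * norm (x - y)))"
      using lipschitz_real_abs_le[OF lip]
      by (intro order_trans[OF sum_abs] sum_mono) (auto simp: abs_mult intro!: mult_left_mono)
    finally show ?thesis by (simp add: sum_distrib_right mult.assoc)
  qed
  show "\<exists>M\<ge>0. \<forall>a b l. 0 < l \<longrightarrow> l < 1 \<longrightarrow> l * u a $ i + (1 - l) * u b $ i - u (l *\<^sub>R a + (1 - l) *\<^sub>R b) $ i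
      \<le> l * (1 - l) * (\<epsilon> * norm (a - b) + M * (norm (a - b))\<^sup>2)"
  proof (rule strictly_convex_imp_semiconcave[OF _ lip, where F = "\<lambda>x p. H i x p + f x"])
    show "Zperiodic (\<lambda>y. u y $ i)" using sol by (simp add: sys_sol_def sys_subsol_def Zperiodic_def)
    show "H i x p + f x \<le> 0" if "p \<in> superdiff (\<lambda>y. u y $ i) x" for x p
      using sol that by (simp add: sys_sol_def sys_subsol_def f_def add_diff_eq)
    show "0 \<le> H i x p + f x" if "p \<in> subdiff (\<lambda>y. u y $ i) x" for x p
      using sol that by (simp add: sys_sol_def sys_supersol_def f_def add_diff_eq)
    show "convex_on UNIV (\<lambda>p. H i x p + f x)" for x
      by (intro convex_on_add H_conv) (simp add: convex_on_const)
    show "\<exists>C\<ge>0. \<forall>x\<in>cball 0 R. \<forall>y\<in>cball 0 R. \<forall>p\<in>cball 0 R. \<bar>(H i x p + f x) - (H i y p + f y)\<bar> \<le> C * norm (x - y)" for R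
    proof -
      obtain K where K: "K-lipschitz_on (cball 0 R \<times> cball 0 R) (\<lambda>(x, p). H i x p)"
        using locally_lipschitz_imp_lipschitz_on_compact[OF H_loclip compact_Times[OF compact_cball compact_cball]] by blast
      define C where "C = K + (\<Sum>j\<in>UNIV. \<bar>A $ i $ j\<bar> * L)"
      have "0 \<le> C" unfolding C_def
        using lipschitz_on_nonneg[OF K] lipschitz_on_nonneg[OF lip] by (intro add_nonneg_nonneg sum_nonneg) auto
      moreover have "\<bar>(H i x p + f x) - (H i y p + f y)\<bar> \<le> C * norm (x - y)"
        if "x \<in> cball 0 R" "y \<in> cball 0 R" "p \<in> cball 0 R" for x y p
      proof -
        have "\<bar>H i x p - H i y p\<bar> \<le> K * norm (x - y)"
          using lipschitz_onD[OF K, of "(x, p)" "(y, p)"] that by (simp add: dist_Pair_Pair dist_norm)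
        then show ?thesis using f_lip[of x y] by (simp add: C_def distrib_right)
      qed
      ultimately show ?thesis by blast
    qed
    show "\<exists>\<delta>>0. \<forall>x\<in>cball 0 R. \<forall>p\<in>cball 0 R. \<forall>q\<in>cball 0 R. \<epsilon> \<le> norm (p - q) \<longrightarrow>
        H i x ((1/2) *\<^sub>R (p + q)) + f x \<le> ((H i x p + f x) + (H i x q + f x)) / 2 - \<delta>" if "0 < \<epsilon>" for R \<epsilon>
      using strictly_convex_uniform[of "H i" \<epsilon> R, OF H_cont H_strict that] by (simp add: add_divide_distrib algebra_simps)
  qed (fact \<open>0 < \<epsilon>\<close>)
qed

theorem theorem4p8:
  fixes H :: "'m::finite \<Rightarrow> real^'n \<Rightarrow> real^'n \<Rightarrow> real"
    and A :: "real^'m^'m"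
  assumes H_cont: "\<And>i. continuous_on UNIV (\<lambda>(x, p). H i x p)"
    and H_per: "\<And>i p. Zperiodic (\<lambda>x. H i x p)"
    and H_conv: "\<And>i x. convex_on UNIV (H i x)"
    and H_coer: "\<And>i x. filterlim (H i x) at_top at_infinity"
    and A_offdiag: "\<And>i j. i \<noteq> j \<Longrightarrow> A $ i $ j \<le> 0"
    and A_rows: "\<And>i. (\<Sum>j\<in>UNIV. A $ i $ j) = 0"
    and A_irred: "\<And>W. W \<noteq> {} \<Longrightarrow> W \<noteq> UNIV \<Longrightarrow> \<exists>i\<in>W. \<exists>j. j \<notin> W \<and> A $ i $ j < 0"
    and H_strict: "\<And>i x. strictly_convex_on UNIV (H i x)"
    and H_loclip: "\<And>i z. \<exists>e>0. \<exists>L. L-lipschitz_on (ball z e) (\<lambda>(x, p). H i x p)"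
  shows "(\<forall>u. sys_subsol H A (crit_value H A) u \<longrightarrow>
            (\<forall>i. \<forall>x\<in>aubry_set H A. superdiff (\<lambda>y. u y $ i) x \<noteq> {}))
       \<and> (\<forall>u. sys_sol H A (crit_value H A) u \<longrightarrow>
            (\<forall>i x. superdiff (\<lambda>y. u y $ i) x \<noteq> {}))"
proof (intro conjI allI impI ballI)
  let ?\<beta> = "crit_value H A"
  have "\<exists>L. \<forall>u i. sys_subsol H A ?\<beta> u \<longrightarrow> L-lipschitz_on UNIV (\<lambda>x. u x $ i)"
    using H_cont H_per H_conv H_coer A_offdiag A_rows A_irred by (rule sys_subsol_equi_lipschitz)
  then obtain L where L: "\<And>u i. sys_subsol H A ?\<beta> u \<Longrightarrow> L-lipschitz_on UNIV (\<lambda>x. u x $ i)"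
    by blast
  have sol: "superdiff (\<lambda>y. u y $ i) x \<noteq> {}" if "sys_sol H A ?\<beta> u" for u i x
    using that L
    by (intro sys_sol_superdiff_nonempty[OF H_cont H_conv H_strict H_loclip, where L = L])
      (auto simp: sys_sol_def)
  then show "superdiff (\<lambda>y. u y $ i) x \<noteq> {}" if "sys_sol H A ?\<beta> u" for u i x
    using that .
  fix u i x assume u: "sys_subsol H A ?\<beta> u" and x: "x \<in> aubry_set H A"
  obtain w where w: "max_crit_subsol H A x (u x) w"
    using H_cont H_per H_conv H_coer A_offdiag A_rows A_irred u by (rule max_crit_subsol_exists)
  \<comment> \<open>The value \<open>u x\<close> is admissible in the definition of the Aubry set
    because \<open>u\<close> itself is a critical subsolution taking it.\<close>
  have "sys_sol H A ?\<beta> w" using x u w by (auto simp: aubry_set_def)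
  then obtain p where "p \<in> superdiff (\<lambda>y. w y $ i) x" using sol by blast
  moreover have "u y $ i \<le> w y $ i" for y using w u by (simp add: max_crit_subsol_def)
  moreover have "u x $ i = w x $ i" using w by (simp add: max_crit_subsol_def)
  ultimately show "superdiff (\<lambda>y. u y $ i) x \<noteq> {}"
    using superdiff_antimono[where u = "\<lambda>y. u y $ i" and w = "\<lambda>y. w y $ i"] by blast
qed

end
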